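(* Let $\gamma_0:\mathbb{S}^1\to\mathbb{R}^2$ be a regular smooth immersed closed curve with $A(\gamma_0)>0$, $\int_{\gamma_0}k\,ds=2\pi$, $K_{osc}(\gamma_0)<K^*$ and $I(\gamma_0)<\exp\big(\frac{K^*}{8\pi^2}\big)$, and let $\gamma:\mathbb{S}^1\times[0,T)\to\mathbb{R}^2$ be the curve diffusion flow with initial data $\gamma_0$ (for which $T=\infty$). Then $$\mathcal{L}\big\{t\in[0,\infty):k(\cdot,t)\not>0\big\}\le\Big(\frac{L(\gamma_0)}{2\pi}\Big)^4-\Big(\frac{A(\gamma_0)}{\pi}\Big)^2,$$ where $\mathcal{L}$ denotes Lebesgue measure and $k(\cdot,t)\not>0$ means that there exists a point $p$ such that $k(p,t)\le0$.
   Context: For a closed immersed plane curve $\gamma$ with arc-length $s$ (where $ds=|\gamma_u|\,du$) and unit normal field $\nu$: the curvature is $k=\langle\gamma_{ss},\nu\rangle$; the length is $L(\gamma)=\int|\gamma_u|\,du$; the signed enclosed area is $A(\gamma)=-\frac12\int_\gamma\langle\gamma,\nu\rangle\,ds$; the average curvature is $\overline{k}=\frac1L\int_\gamma k\,ds$; $K_{osc}(\gamma)=L(\gamma)\int_\gamma(k-\overline{k})^2\,ds$; $I(\gamma)=\frac{L(\gamma)^2}{4\pi A(\gamma)}$. The curve diffusion flow with initial data $\gamma_0$ is the (unique up to the geometric invariances) one-parameter family of immersed closed curves $\gamma:\mathbb{S}^1\times[0,T)\to\mathbb{R}^2$, $\gamma(\cdot,0)=\gamma_0$, with normal velocity $\partial_t^\perp\gamma=-k_{ss}$,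 where $T\in(0,\infty]$ is the maximal existence time; the curves are smooth. The constant is $K^*=\frac{2\pi+12\pi^2-4\pi\sqrt{3\pi}\sqrt{1+3\pi}}{3}$; for this constant, the flow of every such $\gamma_0$ exists for all time and converges to a round circle. *)

theory Defs
  imports "HOL-Analysis.Analysis"
begin

text \<open>
  The plane is the type \<^typ>\<open>complex\<close> with its real inner product. The circle is the reals
  modulo \<open>2 * pi\<close>, so closed curves are \<open>2 * pi\<close>-periodic functions on the real line. A family of
  curves is written \<open>\<gamma> t u\<close>, with \<open>t\<close> the time and \<open>u\<close> the parameter on the circle.
\<close>

definition smooth_curve :: "(real \<Rightarrow> complex) \<Rightarrow> bool" where
  "smooth_curve \<gamma> \<longleftrightarrow>
     (\<forall>n u. ((\<lambda>g v. vector_derivative g (at v)) ^^ n) \<gamma> differentiable (at u))"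

definition immersed_closed_curve :: "(real \<Rightarrow> complex) \<Rightarrow> bool" where
  "immersed_closed_curve \<gamma> \<longleftrightarrow>
     smooth_curve \<gamma> \<and> (\<forall>u. \<gamma> (u + 2 * pi) = \<gamma> u) \<and> (\<forall>u. vector_derivative \<gamma> (at u) \<noteq> 0)"

definition speed :: "(real \<Rightarrow> complex) \<Rightarrow> real \<Rightarrow> real" where
  "speed \<gamma> u = norm (vector_derivative \<gamma> (at u))"

definition arc_deriv :: "(real \<Rightarrow> complex) \<Rightarrow> (real \<Rightarrow> 'a::real_normed_vector) \<Rightarrow> real \<Rightarrow> 'a" where
  "arc_deriv \<gamma> f u = vector_derivative f (at u) /\<^sub>R speed \<gamma> u"

definition arc_integral :: "(real \<Rightarrow> complex) \<Rightarrow> (real \<Rightarrow> real) \<Rightarrow> real" where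
  "arc_integral \<gamma> f = integral {0..2 * pi} (\<lambda>u. f u * speed \<gamma> u)"

text \<open>
  The unit normal is the unit tangent turned by \<open>pi / 2\<close> counterclockwise. It points inwards along a
  counterclockwise circle, which then has positive curvature and positive enclosed area.
\<close>

definition unit_normal :: "(real \<Rightarrow> complex) \<Rightarrow> real \<Rightarrow> complex" where
  "unit_normal \<gamma> u = \<i> * arc_deriv \<gamma> \<gamma> u"

definition curvature :: "(real \<Rightarrow> complex) \<Rightarrow> real \<Rightarrow> real" where
  "curvature \<gamma> u = arc_deriv \<gamma> (arc_deriv \<gamma> \<gamma>) u \<bullet> unit_normal \<gamma> u"

definition curve_length :: "(real \<Rightarrow> complex) \<Rightarrow> real" where
  "curve_length \<gamma> = integral {0..2 * pi} (speed \<gamma>)"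

definition enclosed_area :: "(real \<Rightarrow> complex) \<Rightarrow> real" where
  "enclosed_area \<gamma> = - (1 / 2) * arc_integral \<gamma> (\<lambda>u. \<gamma> u \<bullet> unit_normal \<gamma> u)"

definition average_curvature :: "(real \<Rightarrow> complex) \<Rightarrow> real" where
  "average_curvature \<gamma> = 1 / curve_length \<gamma> * arc_integral \<gamma> (curvature \<gamma>)"

definition K_osc :: "(real \<Rightarrow> complex) \<Rightarrow> real" where
  "K_osc \<gamma> =
     curve_length \<gamma> * arc_integral \<gamma> (\<lambda>u. (curvature \<gamma> u - average_curvature \<gamma>)\<^sup>2)"

definition isoperimetric_ratio :: "(real \<Rightarrow> complex) \<Rightarrow> real" where
  "isoperimetric_ratio \<gamma> = (curve_length \<gamma>)\<^sup>2 / (4 * pi * enclosed_area \<gamma>)"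

definition K_star :: real where
  "K_star = (2 * pi + 12 * pi\<^sup>2 - 4 * pi * sqrt (3 * pi) * sqrt (1 + 3 * pi)) / 3"

definition time_interval :: "ereal \<Rightarrow> real set" where
  "time_interval T = {t. 0 \<le> t \<and> ereal t < T}"

text \<open>
  Joint \<open>C^n\<close> regularity in \<open>(t, u)\<close>: all mixed partial derivatives up to order \<open>n\<close> exist and are
  continuous. Time derivatives are taken within \<open>J\<close>, hence are one-sided at an endpoint of \<open>J\<close>.
\<close>

primrec C_on :: "nat \<Rightarrow> real set \<Rightarrow> (real \<Rightarrow> real \<Rightarrow> complex) \<Rightarrow> bool" where
  "C_on 0 J g \<longleftrightarrow> continuous_on (J \<times> UNIV) (\<lambda>(t, u). g t u)"
| "C_on (Suc n) J g \<longleftrightarrow>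
     (\<exists>g_t g_u.
        (\<forall>t\<in>J. \<forall>u. ((\<lambda>s. g s u) has_vector_derivative g_t t u) (at t within J)
                  \<and> (g t has_vector_derivative g_u t u) (at u))
        \<and> C_on n J g_t \<and> C_on n J g_u)"

definition smooth_family :: "real set \<Rightarrow> (real \<Rightarrow> real \<Rightarrow> complex) \<Rightarrow> bool" where
  "smooth_family J \<gamma> \<longleftrightarrow> (\<forall>n. C_on n J \<gamma>)"

definition curve_diffusion_solution ::
  "(real \<Rightarrow> complex) \<Rightarrow> ereal \<Rightarrow> (real \<Rightarrow> real \<Rightarrow> complex) \<Rightarrow> bool" where
  "curve_diffusion_solution \<gamma>0 T \<gamma> \<longleftrightarrow>
     0 < T \<and>
     smooth_family (time_interval T) \<gamma> \<and>
     (\<forall>t\<in>time_interval T. immersed_closed_curve (\<gamma> t)) \<and>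
     \<gamma> 0 = \<gamma>0 \<and>
     (\<forall>t\<in>time_interval T. \<forall>u.
        vector_derivative (\<lambda>s. \<gamma> s u) (at t within time_interval T) \<bullet> unit_normal (\<gamma> t) u
        = - arc_deriv (\<gamma> t) (arc_deriv (\<gamma> t) (curvature (\<gamma> t))) u)"

text \<open>
  The equation prescribes only the normal velocity, so a solution may fail to extend merely because
  its parametrisation degenerates. Maximality of \<open>T\<close> is therefore measured against all solutions with
  the same initial curve, not against extensions of \<open>\<gamma>\<close>.
\<close>

definition curve_diffusion_flow ::
  "(real \<Rightarrow> complex) \<Rightarrow> ereal \<Rightarrow> (real \<Rightarrow> real \<Rightarrow> complex) \<Rightarrow> bool" where
  "curve_diffusion_flow \<gamma>0 T \<gamma> \<longleftrightarrow>
     curve_diffusion_solution \<gamma>0 T \<gamma> \<and>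
     (\<forall>T' \<gamma>'. curve_diffusion_solution \<gamma>0 T' \<gamma>' \<longrightarrow> T' \<le> T)"

end

theory Submission
  imports Defs
begin

text \<open>
  The bad times are controlled by the speed at which the length \<open>L\<close> decreases. Along the flow the first
  variation formulas give \<open>L' = - \<integral> k\<^sub>s\<^sup>2 ds\<close>, while the enclosed area \<open>A\<close> and the total curvature stay
  constant. The statements on length and area follow from the normal velocity alone, since integration by parts
  over the closed curve removes the tangential part of the velocity. The total curvature is constant because
  the time derivative of its integrand is the derivative of a periodic function along the curve.

  If \<open>k \<le> 0\<close> somewhere, then \<open>k\<close> has a zero, because its integral is \<open>2 * pi > 0\<close>. Cutting the circle at this
  zero, \<open>k\<close> vanishes at both ends of an interval of length \<open>L\<close>, so the Dirichlet form of Wirtinger's inequality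
  bounds \<open>\<integral> k\<^sub>s\<^sup>2 ds\<close> below by \<open>(pi / L)\<^sup>2 \<integral> k\<^sup>2 ds\<close>, and Cauchy-Schwarz bounds \<open>\<integral> k\<^sup>2 ds\<close> below by
  \<open>(2 * pi)\<^sup>2 / L\<close>. Hence \<open>L\<^sup>3 \<integral> k\<^sub>s\<^sup>2 ds \<ge> 4 * pi\<^sup>4\<close> (\<open>dissipation_lower_bound\<close>), which says
  exactly that \<open>(L / (2 * pi))\<^sup>4\<close> decreases at rate at least \<open>1\<close>. At all other times it does not
  increase. The measure of the bad times in \<open>[0, b]\<close> is therefore at most the total drop of this quantity, and by
  \<open>isoperimetric_inequality\<close> and the conservation of area the final value is at least \<open>(A / pi)\<^sup>2\<close>.

  Both integral inequalities come from \<open>weighted_dirichlet_inequality\<close>, which is stated for an arbitrary positive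
  speed, so that curves never have to be parametrised by arc length.
\<close>

section \<open>Calculus on the line and the circle\<close>

lemma has_vector_derivative_quotient:
  fixes f g :: "real \<Rightarrow> 'a::real_normed_field"
  assumes "(f has_vector_derivative f') (at x within S)" "(g has_vector_derivative g') (at x within S)"
    and "g x \<noteq> 0"
  shows "((\<lambda>x. f x / g x) has_vector_derivative (f' * g x - f x * g') / (g x * g x)) (at x within S)"
  using has_derivative_divide'[OF assms(1,2)[unfolded has_vector_derivative_def] assms(3)]
  unfolding has_vector_derivative_def using assms(3)
  by (simp add: scaleR_conv_of_real algebra_simps diff_divide_distrib)

lemma has_vector_derivative_norm:
  fixes f :: "real \<Rightarrow> 'a::real_inner"
  assumes "(f has_vector_derivative f') (at x within S)" "f x \<noteq> 0"
  shows "((\<lambda>x. norm (f x)) has_vector_derivative (f x \<bullet> f') / norm (f x)) (at x within S)"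
proof -
  have "((\<lambda>x. norm (f x)) has_derivative (\<lambda>h. h *\<^sub>R f' \<bullet> sgn (f x))) (at x within S)"
    by (rule has_derivative_compose[OF assms(1)[unfolded has_vector_derivative_def] has_derivative_norm[OF assms(2)]])
  moreover have "h *\<^sub>R f' \<bullet> sgn (f x) = h *\<^sub>R ((f x \<bullet> f') / norm (f x))" for h
    by (simp add: sgn_div_norm inner_commute divide_inverse)
  ultimately show ?thesis unfolding has_vector_derivative_def by simp
qed

text \<open>
  With \<open>\<sigma>\<close> the arc length for the speed \<open>w\<close>, measured from the midpoint, and \<open>c\<close> slightly below
  \<open>pi / l\<close>, the function \<open>tan (c * \<sigma>)\<close> is smooth up to the boundary. Completing the square in
  \<open>(f' + c * w * f * tan (c * \<sigma>))\<^sup>2 / w\<close> leaves \<open>f'\<^sup>2 / w - c\<^sup>2 * w * f\<^sup>2\<close> plus the derivative of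
  \<open>c * f\<^sup>2 * tan (c * \<sigma>)\<close>, whose integral vanishes. Letting \<open>c\<close> tend to \<open>pi / l\<close> gives the sharp
  constant.
\<close>
lemma weighted_dirichlet_inequality:
  fixes f f' w :: "real \<Rightarrow> real"
  assumes ab: "a < b"
    and w: "continuous_on {a..b} w" "\<And>x. x \<in> {a..b} \<Longrightarrow> 0 < w x"
    and f: "\<And>x. x \<in> {a..b} \<Longrightarrow> (f has_real_derivative f' x) (at x within {a..b})"
    and f': "continuous_on {a..b} f'"
    and bdry: "f a = 0" "f b = 0"
  shows "(pi / integral {a..b} w)\<^sup>2 * integral {a..b} (\<lambda>x. (f x)\<^sup>2 * w x)
           \<le> integral {a..b} (\<lambda>x. (f' x)\<^sup>2 / w x)"
proof -
  define l where "l = integral {a..b} w"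
  define \<sigma> where "\<sigma> u = integral {a..u} w - l / 2" for u
  have w0: "w integrable_on {x..y}" if "a \<le> x" "y \<le> b" for x y
    using that by (intro integrable_continuous_real continuous_on_subset[OF w(1)]) auto
  have fc: "continuous_on {a..b} f"
    by (metis f DERIV_continuous continuous_on_eq_continuous_within)
  have l: "0 < l"
  proof -
    have "0 \<le> l" unfolding l_def
      by (rule integral_nonneg[OF w0]) (use w(2) less_imp_le in auto)
    moreover have "l \<noteq> 0"
      using integral_eq_0_iff[OF w(1) ab] w(2) ab unfolding l_def
      by (metis atLeastAtMost_iff less_imp_le order_refl less_irrefl)
    ultimately show ?thesis by simp
  qed
  have \<sigma>_bd: "\<bar>\<sigma> u\<bar> \<le> l / 2" if u: "u \<in> {a..b}" for u
  proof -
    have "integral {a..u} w + integral {u..b} w = l" unfolding l_def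
      using u by (intro Henstock_Kurzweil_Integration.integral_combine w0) auto
    moreover have "0 \<le> integral {a..u} w" "0 \<le> integral {u..b} w"
      using u w(2) by (auto intro!: integral_nonneg[OF w0] intro: less_imp_le)
    ultimately show ?thesis unfolding \<sigma>_def by (simp only: abs_le_iff) linarith
  qed
  have \<sigma>_deriv: "(\<sigma> has_real_derivative w u) (at u within {a..b})" if "u \<in> {a..b}" for u
    unfolding \<sigma>_def using integral_has_real_derivative[OF w(1) that]
    by (auto intro!: derivative_eq_intros)
  define X where "X = integral {a..b} (\<lambda>x. (f x)\<^sup>2 * w x)"
  define Y where "Y = integral {a..b} (\<lambda>x. (f' x)\<^sup>2 / w x)"
  have X: "((\<lambda>x. (f x)\<^sup>2 * w x) has_integral X) {a..b}" unfolding X_def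
    by (intro integrable_integral integrable_continuous_real continuous_intros w fc)
  have Y: "((\<lambda>x. (f' x)\<^sup>2 / w x) has_integral Y) {a..b}" unfolding Y_def
    by (intro integrable_integral integrable_continuous_real continuous_intros w f') (use w(2) in force)
  have key: "c\<^sup>2 * X \<le> Y" if c: "0 < c" "c < pi / l" for c
  proof -
    have cos: "0 < cos (c * \<sigma> u)" if u: "u \<in> {a..b}" for u
    proof -
      have "\<bar>c * \<sigma> u\<bar> \<le> c * (l / 2)"
        using \<sigma>_bd[OF u] c by (simp add: abs_mult)
      also have "\<dots> < pi / 2" using c l by (simp add: field_simps)
      finally show ?thesis by (intro cos_gt_zero_pi) auto
    qed
    define G where "G u = (f u)\<^sup>2 * tan (c * \<sigma> u)" for u
    define G' where "G' u = 2 * f u * f' u * tan (c * \<sigma> u) + (f u)\<^sup>2 * ((1 + (tan (c * \<sigma> u))\<^sup>2) * (c * w u))" for u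
    have G: "(G has_real_derivative G' u) (at u within {a..b})" if u: "u \<in> {a..b}" for u
      unfolding G_def G'_def using cos[OF u] tan_sec[of "c * \<sigma> u"]
      by (auto intro!: derivative_eq_intros f[OF u] \<sigma>_deriv[OF u] simp: power2_eq_square)
    have "(G' has_integral G b - G a) {a..b}"
      using G ab by (intro fundamental_theorem_of_calculus)
        (auto simp: has_real_derivative_iff_has_vector_derivative[symmetric])
    then have G'0: "(G' has_integral 0) {a..b}" by (simp add: G_def bdry)
    have "c\<^sup>2 * X \<le> Y + c * 0"
    proof (rule has_integral_le)
      show "((\<lambda>x. c\<^sup>2 * ((f x)\<^sup>2 * w x)) has_integral c\<^sup>2 * X) {a..b}"
        using X by (rule has_integral_mult_right)
      show "((\<lambda>x. (f' x)\<^sup>2 / w x + c * G' x) has_integral Y + c * 0) {a..b}"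
        by (intro has_integral_add Y has_integral_mult_right G'0)
      fix x assume x: "x \<in> {a..b}"
      have "(f' x)\<^sup>2 / w x + c * G' x - c\<^sup>2 * ((f x)\<^sup>2 * w x)
              = (f' x + f x * (c * w x * tan (c * \<sigma> x)))\<^sup>2 / w x"
        using w(2)[OF x] unfolding G'_def by (simp add: field_simps power2_eq_square)
      also have "\<dots> \<ge> 0" using w(2)[OF x] by simp
      finally show "c\<^sup>2 * ((f x)\<^sup>2 * w x) \<le> (f' x)\<^sup>2 / w x + c * G' x" by simp
    qed
    then show ?thesis by simp
  qed
  have "(pi / l)\<^sup>2 * X \<le> Y"
  proof (rule field_le_mult_one_interval)
    fix z :: real assume z: "0 < z" "z < 1"
    have "(sqrt z * (pi / l))\<^sup>2 * X \<le> Y"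
      using z l by (intro key) (auto simp: field_simps)
    then show "z * ((pi / l)\<^sup>2 * X) \<le> Y" using z by (simp add: power_mult_distrib power_divide mult.assoc)
  qed
  then show ?thesis by (simp add: X_def Y_def l_def)
qed

lemma periodic_value_in_period:
  fixes g :: "real \<Rightarrow> 'a" and P :: real
  assumes per: "\<And>u. g (u + P) = g u" and P: "0 < P"
  obtains r where "r \<in> {0..P}" "g r = g p"
proof -
  interpret periodic_fun_simple g P by unfold_locales (rule per)
  define n where "n = \<lfloor>p / P\<rfloor>"
  have "real_of_int n \<le> p / P" "p / P < real_of_int n + 1"
    unfolding n_def by linarith+
  then have "p - real_of_int n * P \<in> {0..P}" using P by (simp add: field_simps)
  moreover have "g (p - real_of_int n * P) = g p" by (rule minus_of_int)
  ultimately show ?thesis by (rule that)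
qed

lemma integral_over_shifted_period:
  fixes g :: "real \<Rightarrow> real"
  assumes g: "continuous_on UNIV g" and per: "\<And>u. g (u + P) = g u" and p: "0 \<le> p" "p \<le> P"
  shows "integral {p..p + P} g = integral {0..P} g"
proof -
  have gi: "g integrable_on {x..y}" for x y
    by (intro integrable_continuous_real continuous_on_subset[OF g]) auto
  have "integral {0..p} g = integral {P..p + P} g"
    using integral_shift_real_ivl[of P P "p + P" g] per by simp
  moreover have "integral {0..p} g + integral {p..P} g = integral {0..P} g"
    using p gi by (intro Henstock_Kurzweil_Integration.integral_combine) auto
  moreover have "integral {p..P} g + integral {P..p + P} g = integral {p..p + P} g"
    using p gi by (intro Henstock_Kurzweil_Integration.integral_combine) auto
  ultimately show ?thesis by simp
qed

lemma has_integral_periodic_derivative: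
  fixes F :: "real \<Rightarrow> 'a::banach"
  assumes "\<And>u. (F has_vector_derivative F' u) (at u)" and "\<And>u. F (u + 2 * pi) = F u"
  shows "(F' has_integral 0) {0..2 * pi}"
proof -
  have "(F' has_integral F (2 * pi) - F 0) {0..2 * pi}"
    using assms(1) by (intro fundamental_theorem_of_calculus) (auto intro: has_vector_derivative_at_within)
  then show ?thesis using assms(2)[of 0] by simp
qed

lemma periodic_derivative:
  fixes f :: "real \<Rightarrow> 'a::real_normed_vector"
  assumes f: "\<And>u. (f has_vector_derivative f' u) (at u)" and per: "\<And>u. f (u + P) = f u"
  shows "f' (u + P) = f' u"
proof -
  have "((\<lambda>x. f (x + P)) has_vector_derivative 1 *\<^sub>R f' (u + P)) (at u)"
    unfolding o_def[of f "\<lambda>x. x + P", symmetric]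
    by (rule vector_diff_chain_at) (auto intro!: derivative_eq_intros f)
  then show ?thesis using per vector_derivative_unique_at[OF _ f[of u]] by auto
qed

section \<open>Curvature of a closed immersed curve\<close>

locale immersed_curve =
  fixes c :: "real \<Rightarrow> complex"
  assumes immersed: "immersed_closed_curve c"
begin

definition c1 :: "real \<Rightarrow> complex" where "c1 u = vector_derivative c (at u)"
definition c2 :: "real \<Rightarrow> complex" where "c2 u = vector_derivative c1 (at u)"
definition c3 :: "real \<Rightarrow> complex" where "c3 u = vector_derivative c2 (at u)"
definition c4 :: "real \<Rightarrow> complex" where "c4 u = vector_derivative c3 (at u)"

text \<open>
  The logarithmic derivative of the velocity vector: its real part is the logarithmic derivative of the speed, and its
  imaginary part is the curvature times the speed. This turns all curvature formulas into complex arithmetic.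
\<close>
definition log_deriv :: "real \<Rightarrow> complex" where
  "log_deriv u = c2 u / c1 u"

lemma has_derivatives:
  "(c has_vector_derivative c1 u) (at u)" "(c1 has_vector_derivative c2 u) (at u)"
  "(c2 has_vector_derivative c3 u) (at u)" "(c3 has_vector_derivative c4 u) (at u)"
proof -
  have *: "((\<lambda>g v. vector_derivative g (at v)) ^^ n) c differentiable (at u)" for n
    using immersed by (simp add: immersed_closed_curve_def smooth_curve_def)
  note ** = c1_def[abs_def] c2_def[abs_def] c3_def[abs_def] c4_def[abs_def]
  show "(c has_vector_derivative c1 u) (at u)"
    using *[of 0] by (simp add: ** vector_derivative_works)
  show "(c1 has_vector_derivative c2 u) (at u)"
    using *[of "Suc 0"] by (simp add: ** vector_derivative_works)
  show "(c2 has_vector_derivative c3 u) (at u)"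
    using *[of "Suc (Suc 0)"] by (simp add: ** vector_derivative_works)
  show "(c3 has_vector_derivative c4 u) (at u)"
    using *[of "Suc (Suc (Suc 0))"] by (simp add: ** vector_derivative_works)
qed

lemma derivatives_periodic:
  "c (u + 2 * pi) = c u" "c1 (u + 2 * pi) = c1 u" "c2 (u + 2 * pi) = c2 u" "c3 (u + 2 * pi) = c3 u"
proof -
  show 0: "c (u + 2 * pi) = c u" for u using immersed by (simp add: immersed_closed_curve_def)
  show 1: "c1 (u + 2 * pi) = c1 u" for u using has_derivatives(1) 0 by (rule periodic_derivative)
  show 2: "c2 (u + 2 * pi) = c2 u" for u using has_derivatives(2) 1 by (rule periodic_derivative)
  show "c3 (u + 2 * pi) = c3 u" using has_derivatives(3) 2 by (rule periodic_derivative)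
qed

lemma continuous_derivatives [continuous_intros]:
  "continuous_on S c" "continuous_on S c1" "continuous_on S c2" "continuous_on S c3"
  by (meson has_derivatives has_vector_derivative_continuous continuous_at_imp_continuous_on)+

lemma c1_nonzero: "c1 u \<noteq> 0"
  using immersed by (simp add: c1_def immersed_closed_curve_def)

lemma speed_eq: "speed c u = norm (c1 u)"
  by (simp add: speed_def c1_def)

lemma speed_pos: "0 < speed c u"
  using c1_nonzero by (simp add: speed_eq)

lemma speed_nonzero: "speed c u \<noteq> 0"
  using speed_pos[of u] by simp

lemma continuous_speed [continuous_intros]: "continuous_on S (speed c)"
  unfolding speed_eq[abs_def] by (intro continuous_intros)

lemma speed_periodic: "speed c (u + 2 * pi) = speed c u"
  by (simp only: speed_eq derivatives_periodic)

lemma continuous_log_deriv [continuous_intros]: "continuous_on S log_deriv"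
  unfolding log_deriv_def[abs_def] by (intro continuous_intros) (use c1_nonzero in auto)

lemma log_deriv_has_derivative: "(log_deriv has_vector_derivative c3 u / c1 u - (log_deriv u)\<^sup>2) (at u)"
proof -
  have "((\<lambda>u. c2 u / c1 u) has_vector_derivative (c3 u * c1 u - c2 u * c2 u) / (c1 u * c1 u)) (at u)"
    by (rule has_vector_derivative_quotient[OF has_derivatives(3,2) c1_nonzero])
  then show ?thesis
    unfolding log_deriv_def[abs_def] using c1_nonzero[of u] by (simp add: field_simps power2_eq_square)
qed

lemma speed_has_derivative: "(speed c has_real_derivative speed c u * Re (log_deriv u)) (at u)"
proof -
  have "((\<lambda>u. norm (c1 u)) has_vector_derivative (c1 u \<bullet> c2 u) / norm (c1 u)) (at u)"
    by (rule has_vector_derivative_norm[OF has_derivatives(2) c1_nonzero])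
  moreover have "c1 u \<bullet> c2 u = (norm (c1 u))\<^sup>2 * Re (log_deriv u)"
  proof -
    have "c2 u = log_deriv u * c1 u" using c1_nonzero by (simp add: log_deriv_def)
    then show ?thesis unfolding inner_complex_def cmod_power2 by (simp add: power2_eq_square algebra_simps)
  qed
  ultimately show ?thesis
    unfolding speed_eq[abs_def] has_real_derivative_iff_has_vector_derivative
    using c1_nonzero[of u] by (simp add: power2_eq_square)
qed

lemma tangent_eq: "arc_deriv c c u = c1 u / speed c u"
  by (simp add: arc_deriv_def c1_def scaleR_conv_of_real divide_inverse mult.commute)

lemma tangent_periodic: "arc_deriv c c (u + 2 * pi) = arc_deriv c c u"
  by (simp only: tangent_eq speed_periodic derivatives_periodic)

lemma norm_tangent: "norm (arc_deriv c c u) = 1"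
  using speed_pos[of u] unfolding tangent_eq by (simp add: norm_divide speed_eq)

lemma continuous_tangent [continuous_intros]: "continuous_on S (arc_deriv c c)"
  unfolding tangent_eq[abs_def] using speed_pos
  by (intro continuous_intros) (auto simp: less_le)

lemma tangent_has_derivative:
  "(arc_deriv c c has_vector_derivative Im (log_deriv u) *\<^sub>R (\<i> * arc_deriv c c u)) (at u)"
proof -
  let ?v = "speed c u"
  have v: "((\<lambda>u. inverse (speed c u)) has_real_derivative - (?v * Re (log_deriv u)) / ?v\<^sup>2) (at u)"
    using speed_pos[of u]
    by (auto intro!: derivative_eq_intros speed_has_derivative simp: power2_eq_square field_simps)
  have "((\<lambda>u. c1 u /\<^sub>R speed c u) has_vector_derivative
          inverse ?v *\<^sub>R c2 u + (- (?v * Re (log_deriv u)) / ?v\<^sup>2) *\<^sub>R c1 u) (at u)"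
    by (rule has_vector_derivative_scaleR[OF v has_derivatives(2)])
  moreover have "inverse ?v *\<^sub>R c2 u + (- (?v * Re (log_deriv u)) / ?v\<^sup>2) *\<^sub>R c1 u
      = Im (log_deriv u) *\<^sub>R (\<i> * (c1 u /\<^sub>R ?v))"
  proof -
    have "inverse ?v *\<^sub>R c2 u + (- (?v * Re (log_deriv u)) / ?v\<^sup>2) *\<^sub>R c1 u
        = (log_deriv u - Re (log_deriv u)) * (c1 u /\<^sub>R ?v)"
      using c1_nonzero[of u] speed_pos[of u]
      by (simp add: log_deriv_def scaleR_conv_of_real power2_eq_square field_simps)
    also have "log_deriv u - Re (log_deriv u) = \<i> * Im (log_deriv u)"
      by (simp add: complex_eq_iff)
    finally show ?thesis by (simp add: scaleR_conv_of_real algebra_simps)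
  qed
  moreover have "arc_deriv c c = (\<lambda>u. c1 u /\<^sub>R speed c u)"
    by (simp add: arc_deriv_def[abs_def] c1_def)
  ultimately show ?thesis by simp
qed

lemma curvature_eq: "curvature c u = Im (log_deriv u) / speed c u"
proof -
  have "arc_deriv c (arc_deriv c c) u = (Im (log_deriv u) / speed c u) *\<^sub>R (\<i> * arc_deriv c c u)"
    by (simp add: arc_deriv_def[of c "arc_deriv c c"] vector_derivative_at[OF tangent_has_derivative] divide_inverse mult.commute)
  then have "curvature c u = (Im (log_deriv u) / speed c u) * ((\<i> * arc_deriv c c u) \<bullet> (\<i> * arc_deriv c c u))"
    by (simp add: curvature_def unit_normal_def)
  then show ?thesis by (simp add: dot_square_norm norm_mult norm_tangent)
qed

lemma curvature_periodic: "curvature c (u + 2 * pi) = curvature c u"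
  by (simp only: curvature_eq log_deriv_def speed_periodic derivatives_periodic)

lemma continuous_curvature [continuous_intros]: "continuous_on S (curvature c)"
  unfolding curvature_eq[abs_def] using speed_pos
  by (intro continuous_intros) (auto simp: less_le)

lemma curvature_arc_derivative_eq:
  "arc_deriv c (curvature c) u = (Im (c3 u / c1 u - (log_deriv u)\<^sup>2) - Im (log_deriv u) * Re (log_deriv u)) / (speed c u)\<^sup>2"
  and curvature_has_derivative:
  "(curvature c has_real_derivative arc_deriv c (curvature c) u * speed c u) (at u)"
proof -
  let ?q' = "c3 u / c1 u - (log_deriv u)\<^sup>2"
  have "((\<lambda>u. Im (log_deriv u)) has_real_derivative Im ?q') (at u)"
    unfolding has_real_derivative_iff_has_vector_derivative
    by (rule bounded_linear.has_vector_derivative[OF bounded_linear_Im log_deriv_has_derivative])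
  then have *: "(curvature c has_real_derivative (Im ?q' - Im (log_deriv u) * Re (log_deriv u)) / speed c u) (at u)"
    unfolding curvature_eq[abs_def] using speed_pos[of u]
    by (auto intro!: DERIV_cong[OF DERIV_divide[OF _ speed_has_derivative]] simp: field_simps)
  then show "arc_deriv c (curvature c) u = (Im ?q' - Im (log_deriv u) * Re (log_deriv u)) / (speed c u)\<^sup>2"
    unfolding arc_deriv_def has_real_derivative_iff_has_vector_derivative
    by (simp add: vector_derivative_at power2_eq_square field_simps)
  with * show "(curvature c has_real_derivative arc_deriv c (curvature c) u * speed c u) (at u)"
    using speed_pos[of u] by (simp add: power2_eq_square)
qed

lemma curvature_arc_derivative_periodic:
  "arc_deriv c (curvature c) (u + 2 * pi) = arc_deriv c (curvature c) u"
  by (simp only: curvature_arc_derivative_eq log_deriv_def speed_periodic derivatives_periodic)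

lemma continuous_curvature_arc_derivative [continuous_intros]:
  "continuous_on S (arc_deriv c (curvature c))"
  unfolding curvature_arc_derivative_eq[abs_def] using speed_pos c1_nonzero
  by (intro continuous_intros) (auto simp: less_le)

lemma curvature_arc_derivative_has_derivative:
  "(arc_deriv c (curvature c) has_real_derivative
      arc_deriv c (arc_deriv c (curvature c)) u * speed c u) (at u)"
proof -
  have "(\<lambda>u. Im (c3 u / c1 u - (log_deriv u)\<^sup>2)) differentiable (at u)"
  proof -
    have "c3 differentiable (at u)" "c1 differentiable (at u)" "log_deriv differentiable (at u)"
      by (blast intro: differentiableI_vector has_derivatives log_deriv_has_derivative)+
    then have "(\<lambda>u. c3 u / c1 u - (log_deriv u)\<^sup>2) differentiable (at u)"
      using c1_nonzero by (intro derivative_intros) auto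
    then show ?thesis unfolding differentiable_def
      using bounded_linear.has_derivative[OF bounded_linear_Im] by blast
  qed
  moreover have "(\<lambda>u. Im (log_deriv u)) differentiable (at u)" "(\<lambda>u. Re (log_deriv u)) differentiable (at u)"
    using bounded_linear.has_vector_derivative[OF _ log_deriv_has_derivative] bounded_linear_Im bounded_linear_Re
    by (blast intro: differentiableI_vector)+
  moreover have "speed c differentiable (at u)"
    by (meson speed_has_derivative real_differentiable_def)
  ultimately have "arc_deriv c (curvature c) differentiable (at u)"
    unfolding curvature_arc_derivative_eq[abs_def] using speed_pos[of u]
    by (auto intro!: derivative_intros)
  then show ?thesis using speed_pos[of u]
    unfolding has_real_derivative_iff_has_vector_derivative arc_deriv_def[of _ "arc_deriv c (curvature c)"]
    by (simp add: vector_derivative_works field_simps)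
qed

lemma arc_integral_curvature_eq: "arc_integral c (curvature c) = integral {0..2 * pi} (\<lambda>u. Im (log_deriv u))"
  unfolding arc_integral_def by (simp add: curvature_eq speed_nonzero)

lemma curve_length_pos: "0 < curve_length c"
proof -
  have "0 \<le> curve_length c" unfolding curve_length_def
    by (intro integral_nonneg integrable_continuous_real continuous_intros) (simp add: less_imp_le speed_pos)
  moreover have "curve_length c \<noteq> 0"
    using integral_eq_0_iff[OF continuous_speed, of 0 "2 * pi"] speed_pos unfolding curve_length_def
    by (metis atLeastAtMost_iff less_imp_le less_irrefl mult_pos_pos order_refl pi_gt_zero zero_less_numeral)
  ultimately show ?thesis by simp
qed

section \<open>First variation and dissipation\<close>

lemma second_curvature_derivative_integral:
  "arc_integral c (arc_deriv c (arc_deriv c (curvature c))) = 0"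
  unfolding arc_integral_def
  using has_integral_periodic_derivative[of "arc_deriv c (curvature c)"]
    curvature_arc_derivative_has_derivative curvature_arc_derivative_periodic
  by (auto simp: has_real_derivative_iff_has_vector_derivative)

text \<open>
  Integration by parts over the closed curve. The integral of \<open>k * k\<^sub>s\<^sub>s\<close> is recovered from that of \<open>k\<^sub>s\<^sup>2\<close>,
  which exists by continuity, so that \<open>k\<^sub>s\<close> only has to be differentiable.
\<close>
lemma curvature_dissipation:
  "arc_integral c (\<lambda>u. curvature c u * arc_deriv c (arc_deriv c (curvature c)) u)
     = - arc_integral c (\<lambda>u. (arc_deriv c (curvature c) u)\<^sup>2)"
proof -
  let ?k = "curvature c" and ?k1 = "arc_deriv c (curvature c)"
  let ?k2 = "arc_deriv c (arc_deriv c (curvature c))"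
  have "((\<lambda>u. ?k u * ?k1 u) has_real_derivative ?k u * (?k2 u * speed c u) + ?k1 u * speed c u * ?k1 u) (at u)" for u
    by (rule DERIV_mult' curvature_has_derivative curvature_arc_derivative_has_derivative)+
  then have "((\<lambda>u. ?k u * (?k2 u * speed c u) + ?k1 u * speed c u * ?k1 u) has_integral 0) {0..2 * pi}"
    by (intro has_integral_periodic_derivative[of "\<lambda>u. ?k u * ?k1 u"])
      (simp_all add: has_real_derivative_iff_has_vector_derivative curvature_periodic curvature_arc_derivative_periodic)
  moreover have "((\<lambda>u. (?k1 u)\<^sup>2 * speed c u) has_integral arc_integral c (\<lambda>u. (?k1 u)\<^sup>2)) {0..2 * pi}"
    unfolding arc_integral_def by (intro integrable_integral integrable_continuous_real continuous_intros)
  ultimately have "((\<lambda>u. ?k u * (?k2 u * speed c u) + ?k1 u * speed c u * ?k1 u - (?k1 u)\<^sup>2 * speed c u)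
      has_integral 0 - arc_integral c (\<lambda>u. (?k1 u)\<^sup>2)) {0..2 * pi}"
    by (rule has_integral_diff)
  then show ?thesis unfolding arc_integral_def[of _ "\<lambda>u. ?k u * _ u"]
    by (intro integral_unique) (simp add: power2_eq_square algebra_simps)
qed

text \<open>
  The left-hand side is the rate of change of the length when the curve moves with velocity \<open>W\<close>.
  Integrating \<open>W \<bullet> \<tau>\<close> by parts moves the derivative from \<open>W\<close> to the unit tangent \<open>\<tau>\<close>, whose derivative is
  normal; hence only the normal component of \<open>W\<close> survives.
\<close>
lemma first_variation_of_length:
  assumes W: "\<And>u. (W has_vector_derivative W' u) (at u)" and per: "\<And>u. W (u + 2 * pi) = W u"
  shows "integral {0..2 * pi} (\<lambda>u. (c1 u \<bullet> W' u) / norm (c1 u))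
           = - arc_integral c (\<lambda>u. curvature c u * (W u \<bullet> unit_normal c u))"
proof -
  let ?\<tau> = "arc_deriv c c"
  have Wc: "continuous_on {0..2 * pi} W"
    by (meson W has_vector_derivative_continuous continuous_at_imp_continuous_on)
  let ?I = "\<lambda>u. curvature c u * (W u \<bullet> unit_normal c u) * speed c u"
  have "((\<lambda>u. W u \<bullet> ?\<tau> u) has_vector_derivative W u \<bullet> (Im (log_deriv u) *\<^sub>R (\<i> * ?\<tau> u)) + W' u \<bullet> ?\<tau> u) (at u)" for u
    by (rule bounded_bilinear.has_vector_derivative[OF bounded_bilinear_inner W tangent_has_derivative])
  then have "((\<lambda>u. W u \<bullet> (Im (log_deriv u) *\<^sub>R (\<i> * ?\<tau> u)) + W' u \<bullet> ?\<tau> u) has_integral 0) {0..2 * pi}"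
    by (intro has_integral_periodic_derivative[of "\<lambda>u. W u \<bullet> ?\<tau> u"]) (simp_all add: per tangent_periodic)
  moreover have "(?I has_integral integral {0..2 * pi} ?I) {0..2 * pi}"
    unfolding unit_normal_def by (intro integrable_integral integrable_continuous_real continuous_intros Wc)
  ultimately have "((\<lambda>u. W u \<bullet> (Im (log_deriv u) *\<^sub>R (\<i> * ?\<tau> u)) + W' u \<bullet> ?\<tau> u - ?I u) has_integral
      0 - integral {0..2 * pi} ?I) {0..2 * pi}"
    by (rule has_integral_diff)
  moreover have "W u \<bullet> (Im (log_deriv u) *\<^sub>R (\<i> * ?\<tau> u)) + W' u \<bullet> ?\<tau> u - ?I u = (c1 u \<bullet> W' u) / norm (c1 u)" for u
  proof -
    have "?\<tau> u = (1 / norm (c1 u)) *\<^sub>R c1 u"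
      by (simp add: tangent_eq speed_eq scaleR_conv_of_real)
    then show ?thesis
      using speed_pos[of u] by (simp add: curvature_eq unit_normal_def inner_commute)
  qed
  ultimately show ?thesis unfolding arc_integral_def by (intro integral_unique) simp
qed

lemma enclosed_area_eq: "enclosed_area c = - (1 / 2) * integral {0..2 * pi} (\<lambda>u. c u \<bullet> (\<i> * c1 u))"
proof -
  have "c u \<bullet> unit_normal c u * speed c u = c u \<bullet> (\<i> * c1 u)" for u
  proof -
    have "unit_normal c u = (1 / speed c u) *\<^sub>R (\<i> * c1 u)"
      by (simp add: tangent_eq unit_normal_def scaleR_conv_of_real)
    then show ?thesis using speed_pos[of u] by simp
  qed
  then show ?thesis by (simp add: enclosed_area_def arc_integral_def)
qed

text \<open>
  The left-hand side is minus twice the rate of change of the enclosed area when the curve moves with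
  velocity \<open>W\<close>; integrating \<open>c \<bullet> (\<i> * W)\<close> by parts makes its two terms equal.
\<close>
lemma first_variation_of_area:
  assumes W: "\<And>u. (W has_vector_derivative W' u) (at u)" and per: "\<And>u. W (u + 2 * pi) = W u"
  shows "integral {0..2 * pi} (\<lambda>u. c u \<bullet> (\<i> * W' u) + W u \<bullet> (\<i> * c1 u))
           = 2 * arc_integral c (\<lambda>u. W u \<bullet> unit_normal c u)"
proof -
  have Wc: "continuous_on {0..2 * pi} W"
    by (meson W has_vector_derivative_continuous continuous_at_imp_continuous_on)
  let ?I = "\<lambda>u. W u \<bullet> unit_normal c u * speed c u"
  have "((\<lambda>u. c u \<bullet> (\<i> * W u)) has_vector_derivative c u \<bullet> (\<i> * W' u) + c1 u \<bullet> (\<i> * W u)) (at u)" for u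
    by (intro bounded_bilinear.has_vector_derivative[OF bounded_bilinear_inner]
        has_derivatives(1) has_vector_derivative_mult_right W)
  then have "((\<lambda>u. c u \<bullet> (\<i> * W' u) + c1 u \<bullet> (\<i> * W u)) has_integral 0) {0..2 * pi}"
    using derivatives_periodic
    by (intro has_integral_periodic_derivative[of "\<lambda>u. c u \<bullet> (\<i> * W u)"]) (simp_all add: per)
  moreover have "(?I has_integral arc_integral c (\<lambda>u. W u \<bullet> unit_normal c u)) {0..2 * pi}"
    unfolding unit_normal_def arc_integral_def
    by (intro integrable_integral integrable_continuous_real continuous_intros Wc)
  then have "((\<lambda>u. 2 * ?I u) has_integral 2 * arc_integral c (\<lambda>u. W u \<bullet> unit_normal c u)) {0..2 * pi}"
    by (rule has_integral_mult_right)
  ultimately have "((\<lambda>u. c u \<bullet> (\<i> * W' u) + c1 u \<bullet> (\<i> * W u) + 2 * ?I u) has_integral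
      0 + 2 * arc_integral c (\<lambda>u. W u \<bullet> unit_normal c u)) {0..2 * pi}"
    by (rule has_integral_add)
  moreover have "c u \<bullet> (\<i> * W' u) + c1 u \<bullet> (\<i> * W u) + 2 * ?I u = c u \<bullet> (\<i> * W' u) + W u \<bullet> (\<i> * c1 u)" for u
  proof -
    have "unit_normal c u = (1 / speed c u) *\<^sub>R (\<i> * c1 u)"
      by (simp add: tangent_eq unit_normal_def scaleR_conv_of_real)
    then have "?I u = W u \<bullet> (\<i> * c1 u)" using speed_pos[of u] by simp
    moreover have "c1 u \<bullet> (\<i> * W u) = - (W u \<bullet> (\<i> * c1 u))" by (simp add: inner_complex_def)
    ultimately show ?thesis by simp
  qed
  ultimately show ?thesis by (intro integral_unique) simp
qed

section \<open>Isoperimetric inequality and lower bound for the dissipation\<close>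

lemma curvature_vanishes_somewhere:
  assumes turn: "arc_integral c (curvature c) = 2 * pi" and p: "curvature c p \<le> 0"
  obtains r where "r \<in> {0..2 * pi}" "curvature c r = 0"
proof -
  obtain u where u: "0 < curvature c u"
  proof (rule ccontr)
    assume "\<not> thesis"
    then have "curvature c u \<le> 0" for u using that by (meson not_le)
    then have "arc_integral c (curvature c) \<le> integral {0..2 * pi} (\<lambda>_. 0)"
      unfolding arc_integral_def
      by (intro integral_le integrable_continuous_real continuous_intros)
        (simp add: mult_nonpos_nonneg less_imp_le speed_pos)
    then show False using turn by simp (use pi_gt_zero in linarith)
  qed
  have conn: "connected (curvature c ` UNIV)"
    by (intro connected_continuous_image continuous_intros) simp
  have "0 \<in> curvature c ` UNIV"
    using connectedD_interval[OF conn, of "curvature c p" "curvature c u" 0] p u by auto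
  then obtain x where "curvature c x = 0" by auto
  then show ?thesis
    using periodic_value_in_period[of "curvature c" "2 * pi" x] curvature_periodic that by auto
qed

text \<open>
  The constant is that of the Dirichlet inequality on an interval of length \<open>L\<close>, which applies because the
  period can be cut at a zero of the curvature, multiplied by the Cauchy-Schwarz bound for the integral of the
  squared curvature.
\<close>
lemma dissipation_lower_bound:
  assumes turn: "arc_integral c (curvature c) = 2 * pi" and p: "curvature c p \<le> 0"
  shows "4 * pi ^ 4 \<le> curve_length c ^ 3 * arc_integral c (\<lambda>u. (arc_deriv c (curvature c) u)\<^sup>2)"
proof -
  let ?k = "curvature c" and ?k1 = "arc_deriv c (curvature c)" and ?v = "speed c"
  define L where "L = curve_length c"
  have L: "0 < L" unfolding L_def by (rule curve_length_pos)
  obtain r where r: "r \<in> {0..2 * pi}" "?k r = 0"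
    using curvature_vanishes_somewhere[OF turn p] .
  have shift: "integral {r..r + 2 * pi} g = integral {0..2 * pi} g"
    if "continuous_on UNIV g" "\<And>u. g (u + 2 * pi) = g u" for g :: "real \<Rightarrow> real"
    using that r by (intro integral_over_shifted_period) auto
  have "(pi / integral {r..r + 2 * pi} ?v)\<^sup>2 * integral {r..r + 2 * pi} (\<lambda>u. (?k u)\<^sup>2 * ?v u)
      \<le> integral {r..r + 2 * pi} (\<lambda>u. (?k1 u * ?v u)\<^sup>2 / ?v u)"
  proof (rule weighted_dirichlet_inequality)
    show "continuous_on {r..r + 2 * pi} (\<lambda>u. ?k1 u * ?v u)" by (intro continuous_intros)
    show "(?k has_real_derivative ?k1 u * ?v u) (at u within {r..r + 2 * pi})" for u
      by (rule has_field_derivative_at_within[OF curvature_has_derivative])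
    show "?k (r + 2 * pi) = 0" using r by (simp add: curvature_periodic)
  qed (use r in \<open>simp_all add: speed_pos continuous_speed\<close>)
  also have "(\<lambda>u. (?k1 u * ?v u)\<^sup>2 / ?v u) = (\<lambda>u. (?k1 u)\<^sup>2 * ?v u)"
    by (simp add: fun_eq_iff power2_eq_square speed_nonzero)
  also have "integral {r..r + 2 * pi} ?v = L"
    unfolding L_def curve_length_def by (intro shift continuous_intros speed_periodic)
  also have "integral {r..r + 2 * pi} (\<lambda>u. (?k u)\<^sup>2 * ?v u) = arc_integral c (\<lambda>u. (?k u)\<^sup>2)"
    unfolding arc_integral_def
    by (intro shift continuous_intros) (simp add: speed_periodic curvature_periodic)
  also have "integral {r..r + 2 * pi} (\<lambda>u. (?k1 u)\<^sup>2 * ?v u) = arc_integral c (\<lambda>u. (?k1 u)\<^sup>2)"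
    unfolding arc_integral_def
    by (intro shift continuous_intros) (simp add: speed_periodic curvature_arc_derivative_periodic)
  finally have poincare: "(pi / L)\<^sup>2 * arc_integral c (\<lambda>u. (?k u)\<^sup>2) \<le> arc_integral c (\<lambda>u. (?k1 u)\<^sup>2)" .
  have "4 * pi\<^sup>2 / L \<le> arc_integral c (\<lambda>u. (?k u)\<^sup>2)"
  proof -
    \<comment> \<open>Cauchy-Schwarz in the form that the variance of the curvature about its mean \<open>m\<close> is nonnegative.\<close>
    define m where "m = 2 * pi / L"
    have "(?v has_integral L) {0..2 * pi}"
      unfolding L_def curve_length_def by (intro integrable_integral integrable_continuous_real continuous_intros)
    moreover have "((\<lambda>u. ?k u * ?v u) has_integral arc_integral c ?k) {0..2 * pi}"
      unfolding arc_integral_def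
      by (intro integrable_integral integrable_continuous_real continuous_intros)
    moreover have "((\<lambda>u. (?k u)\<^sup>2 * ?v u) has_integral arc_integral c (\<lambda>u. (?k u)\<^sup>2)) {0..2 * pi}"
      unfolding arc_integral_def by (intro integrable_integral integrable_continuous_real continuous_intros)
    ultimately have "((\<lambda>u. (?k u)\<^sup>2 * ?v u - 2 * m * (?k u * ?v u) + m\<^sup>2 * ?v u) has_integral
        arc_integral c (\<lambda>u. (?k u)\<^sup>2) - 2 * m * arc_integral c ?k + m\<^sup>2 * L) {0..2 * pi}"
      by (intro has_integral_add has_integral_diff has_integral_mult_right)
    moreover have "0 \<le> (?k u)\<^sup>2 * ?v u - 2 * m * (?k u * ?v u) + m\<^sup>2 * ?v u" for u
    proof -
      have "0 \<le> (?k u - m)\<^sup>2 * ?v u" using speed_pos[of u] by simp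
      then show ?thesis by (simp add: power2_eq_square algebra_simps)
    qed
    ultimately have "0 \<le> arc_integral c (\<lambda>u. (?k u)\<^sup>2) - 2 * m * arc_integral c ?k + m\<^sup>2 * L"
      by (rule has_integral_nonneg) 
    then show ?thesis using L by (simp add: turn m_def power2_eq_square field_simps)
  qed
  then have "(pi / L)\<^sup>2 * (4 * pi\<^sup>2 / L) \<le> arc_integral c (\<lambda>u. (?k1 u)\<^sup>2)"
    using poincare by (meson mult_left_mono order_trans zero_le_power2)
  then have "L ^ 3 * ((pi / L)\<^sup>2 * (4 * pi\<^sup>2 / L)) \<le> L ^ 3 * arc_integral c (\<lambda>u. (?k1 u)\<^sup>2)"
    using L by (intro mult_left_mono) auto
  moreover have "L ^ 3 * ((pi / L)\<^sup>2 * (4 * pi\<^sup>2 / L)) = 4 * pi ^ 4"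
    using L by (simp add: power2_eq_square power3_eq_cube power4_eq_xxxx)
  ultimately show ?thesis by (simp add: L_def)
qed

lemma half_length_point:
  obtains b where "0 < b" "b < 2 * pi" "integral {0..b} (speed c) = curve_length c / 2"
    "integral {b..2 * pi} (speed c) = curve_length c / 2"
proof -
  let ?s = "\<lambda>u. integral {0..u} (speed c)"
  have int: "speed c integrable_on {x..y}" for x y
    by (intro integrable_continuous_real continuous_intros)
  have "continuous_on {0..2 * pi} ?s" by (rule indefinite_integral_continuous_1[OF int])
  moreover have "?s 0 \<le> curve_length c / 2" "curve_length c / 2 \<le> ?s (2 * pi)"
    using curve_length_pos by (simp_all add: curve_length_def)
  ultimately obtain b where b: "0 \<le> b" "b \<le> 2 * pi" "?s b = curve_length c / 2"
    using IVT'[of ?s 0 "curve_length c / 2" "2 * pi"] by auto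
  have sum: "?s b + integral {b..2 * pi} (speed c) = curve_length c"
    unfolding curve_length_def by (rule Henstock_Kurzweil_Integration.integral_combine[OF b(1,2) int])
  have "b \<noteq> 0" "b \<noteq> 2 * pi" using b(3) curve_length_pos by (auto simp: curve_length_def)
  then show ?thesis using b sum by (intro that[of b]) linarith+
qed

text \<open>
  Two points that halve the length span a chord. The distance \<open>f\<close> to the line through them vanishes at
  both points, so the Dirichlet inequality on each half gives Wirtinger's inequality for \<open>f\<close> on the whole curve
  with the sharp constant \<open>(2 * pi / L)\<^sup>2\<close>. In the coordinates \<open>g\<close> along the line and \<open>f\<close> across it
  the area is \<open>- \<integral> f dg\<close>, and the inequality between arithmetic and geometric means finishes the proof.
\<close>
lemma isoperimetric_inequality: "4 * pi * enclosed_area c \<le> (curve_length c)\<^sup>2"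
proof -
  let ?v = "speed c"
  define L where "L = curve_length c"
  have L: "0 < L" unfolding L_def by (rule curve_length_pos)
  obtain b where b: "0 < b" "b < 2 * pi" "integral {0..b} ?v = L / 2" "integral {b..2 * pi} ?v = L / 2"
    using half_length_point unfolding L_def .
  \<comment> \<open>Multiplication by \<open>w\<close> rotates the chord onto the real axis; a degenerate chord needs no rotation.\<close>
  obtain w where w: "norm w = 1" "Im (w * (c b - c 0)) = 0"
  proof (cases "c b = c 0")
    case False
    have "w * (c b - c 0) = norm (c b - c 0)" if "w = cnj (sgn (c b - c 0))" for w
    proof -
      have "w * (c b - c 0) = (c b - c 0) * cnj (c b - c 0) / norm (c b - c 0)"
        by (simp add: that sgn_div_norm scaleR_conv_of_real divide_inverse)
      also have "\<dots> = norm (c b - c 0)"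
        using False unfolding complex_norm_square[symmetric] by (simp add: power2_eq_square)
      finally show ?thesis .
    qed
    then show ?thesis using False that[of "cnj (sgn (c b - c 0))"] by (simp add: norm_sgn)
  qed (use that[of 1] in simp)
  define f where "f u = Im (w * (c u - c 0))" for u
  define g where "g u = Re (w * (c u - c 0))" for u
  define f' where "f' u = Im (w * c1 u)" for u
  define g' where "g' u = Re (w * c1 u)" for u
  have z: "((\<lambda>u. w * (c u - c 0)) has_vector_derivative w * c1 u) (at u)" for u
    using bounded_linear.has_vector_derivative[OF bounded_linear_mult_right[of w]
        has_vector_derivative_diff[OF has_derivatives(1)[of u] has_vector_derivative_const[of "c 0"]]]
    by simp
  have f: "(f has_real_derivative f' u) (at u)" and g: "(g has_real_derivative g' u) (at u)" for u
    unfolding f_def[abs_def] f'_def g_def[abs_def] g'_def has_real_derivative_iff_has_vector_derivative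
    by (rule bounded_linear.has_vector_derivative[OF _ z], rule bounded_linear_Im bounded_linear_Re)+
  have cont [continuous_intros]: "continuous_on S f" "continuous_on S g" "continuous_on S f'" "continuous_on S g'" for S
    unfolding f_def[abs_def] f'_def[abs_def] g_def[abs_def] g'_def[abs_def] by (intro continuous_intros)+
  have zeros: "f 0 = 0" "f b = 0" "f (2 * pi) = 0"
    using w(2) derivatives_periodic(1)[of 0] by (simp_all add: f_def)
  have sq: "(f' u)\<^sup>2 + (g' u)\<^sup>2 = (?v u)\<^sup>2" for u
  proof -
    have "(f' u)\<^sup>2 + (g' u)\<^sup>2 = (norm (w * c1 u))\<^sup>2" unfolding f'_def g'_def cmod_power2 by simp
    then show ?thesis using w(1) by (simp add: norm_mult speed_eq)
  qed
  have half: "(2 * pi / L)\<^sup>2 * integral {x..y} (\<lambda>u. (f u)\<^sup>2 * ?v u) \<le> integral {x..y} (\<lambda>u. (f' u)\<^sup>2 / ?v u)"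
    if "x < y" "integral {x..y} ?v = L / 2" "f x = 0" "f y = 0" for x y
    using weighted_dirichlet_inequality[of x y ?v f f'] that speed_pos
      has_field_derivative_at_within[OF f] cont continuous_speed
    by (simp add: mult.commute)
  have int: "h integrable_on {x..y}" if "continuous_on UNIV h" for h :: "real \<Rightarrow> real" and x y
    by (intro integrable_continuous_real continuous_on_subset[OF that]) simp
  have c_f2: "continuous_on UNIV (\<lambda>u. (f u)\<^sup>2 * ?v u)" and c_f'2: "continuous_on UNIV (\<lambda>u. (f' u)\<^sup>2 / ?v u)"
    and c_g'2: "continuous_on UNIV (\<lambda>u. (g' u)\<^sup>2 / ?v u)" and c_fg: "continuous_on UNIV (\<lambda>u. f u * g' u)"
    by (auto intro!: continuous_intros simp: speed_nonzero)
  have combine: "integral {0..2 * pi} h = integral {0..b} h + integral {b..2 * pi} h"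
    if "continuous_on UNIV h" for h :: "real \<Rightarrow> real"
    using Henstock_Kurzweil_Integration.integral_combine[of 0 b "2 * pi" h] b int[OF that] by simp
  have wirtinger: "(2 * pi / L)\<^sup>2 * integral {0..2 * pi} (\<lambda>u. (f u)\<^sup>2 * ?v u)
      \<le> integral {0..2 * pi} (\<lambda>u. (f' u)\<^sup>2 / ?v u)"
    using half[of 0 b] half[of b "2 * pi"] b zeros
    unfolding combine[OF c_f2] combine[OF c_f'2] by (simp add: distrib_left)
  have area: "enclosed_area c = - integral {0..2 * pi} (\<lambda>u. f u * g' u)"
  proof -
    have "((\<lambda>u. c 0 \<bullet> (\<i> * c u)) has_vector_derivative c 0 \<bullet> (\<i> * c1 u)) (at u)" for u
      by (intro bounded_linear.has_vector_derivative[OF bounded_linear_inner_right]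
          has_vector_derivative_mult_right has_derivatives(1))
    then have 1: "((\<lambda>u. c 0 \<bullet> (\<i> * c1 u)) has_integral 0) {0..2 * pi}"
      by (intro has_integral_periodic_derivative[of "\<lambda>u. c 0 \<bullet> (\<i> * c u)"]) (simp_all add: derivatives_periodic)
    have "((\<lambda>u. f u * g u) has_real_derivative f u * g' u + f' u * g u) (at u)" for u
      by (rule DERIV_mult' f g)+
    then have 2: "((\<lambda>u. f u * g' u + f' u * g u) has_integral 0) {0..2 * pi}"
      by (intro has_integral_periodic_derivative[of "\<lambda>u. f u * g u"])
        (simp_all add: has_real_derivative_iff_has_vector_derivative f_def g_def derivatives_periodic)
    have 3: "((\<lambda>u. 2 * (f u * g' u)) has_integral 2 * integral {0..2 * pi} (\<lambda>u. f u * g' u)) {0..2 * pi}"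
      by (intro has_integral_mult_right integrable_integral int c_fg)
    have eq: "c u \<bullet> (\<i> * c1 u) = 2 * (f u * g' u) - (f u * g' u + f' u * g u) + c 0 \<bullet> (\<i> * c1 u)" for u
    proof -
      have "(w * a) \<bullet> (w * b) = a \<bullet> b" for a b
      proof -
        have "(w * a) \<bullet> (w * b) = (norm w)\<^sup>2 * (a \<bullet> b)"
          unfolding inner_complex_def cmod_power2 by (simp add: power2_eq_square algebra_simps)
        then show ?thesis using w(1) by simp
      qed
      then have "(c u - c 0) \<bullet> (\<i> * c1 u) = (w * (c u - c 0)) \<bullet> (w * (\<i> * c1 u))" by simp
      also have "w * (\<i> * c1 u) = \<i> * (w * c1 u)" by simp
      also have "(w * (c u - c 0)) \<bullet> (\<i> * (w * c1 u)) = f u * g' u - g u * f' u"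
        unfolding inner_complex_def f_def g_def f'_def g'_def by (simp add: algebra_simps)
      finally show ?thesis by (simp add: inner_diff_left algebra_simps)
    qed
    have "((\<lambda>u. c u \<bullet> (\<i> * c1 u)) has_integral
        2 * integral {0..2 * pi} (\<lambda>u. f u * g' u) - 0 + 0) {0..2 * pi}"
      unfolding eq by (intro has_integral_add has_integral_diff 1 2 3)
    then show ?thesis by (simp add: enclosed_area_eq integral_unique)
  qed
  \<comment> \<open>The weights are chosen so that \<open>f\<^sup>2\<close> is absorbed by Wirtinger's inequality.\<close>
  have pointwise: "- 2 * (2 * pi / L) * (f u * g' u) \<le> (2 * pi / L)\<^sup>2 * ((f u)\<^sup>2 * ?v u) + (g' u)\<^sup>2 / ?v u" for u
  proof -
    have "0 \<le> ((2 * pi / L) * f u * ?v u + g' u)\<^sup>2 / ?v u" using speed_pos[of u] by simp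
    also have "\<dots> = (2 * pi / L)\<^sup>2 * ((f u)\<^sup>2 * ?v u) + (g' u)\<^sup>2 / ?v u + 2 * (2 * pi / L) * (f u * g' u)"
      using speed_pos[of u] L by (simp add: power2_eq_square field_simps)
    finally show ?thesis by simp
  qed
  have "- 2 * (2 * pi / L) * integral {0..2 * pi} (\<lambda>u. f u * g' u)
      \<le> (2 * pi / L)\<^sup>2 * integral {0..2 * pi} (\<lambda>u. (f u)\<^sup>2 * ?v u) + integral {0..2 * pi} (\<lambda>u. (g' u)\<^sup>2 / ?v u)"
  proof (rule has_integral_le)
    show "((\<lambda>u. - 2 * (2 * pi / L) * (f u * g' u)) has_integral
        - 2 * (2 * pi / L) * integral {0..2 * pi} (\<lambda>u. f u * g' u)) {0..2 * pi}"
      by (intro has_integral_mult_right integrable_integral int c_fg)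
    show "((\<lambda>u. (2 * pi / L)\<^sup>2 * ((f u)\<^sup>2 * ?v u) + (g' u)\<^sup>2 / ?v u) has_integral
        (2 * pi / L)\<^sup>2 * integral {0..2 * pi} (\<lambda>u. (f u)\<^sup>2 * ?v u)
          + integral {0..2 * pi} (\<lambda>u. (g' u)\<^sup>2 / ?v u)) {0..2 * pi}"
      by (intro has_integral_add has_integral_mult_right integrable_integral int c_f2 c_g'2)
  qed (rule pointwise)
  then have "2 * (2 * pi / L) * enclosed_area c
      \<le> (2 * pi / L)\<^sup>2 * integral {0..2 * pi} (\<lambda>u. (f u)\<^sup>2 * ?v u) + integral {0..2 * pi} (\<lambda>u. (g' u)\<^sup>2 / ?v u)"
    by (simp add: area)
  also have "\<dots> \<le> integral {0..2 * pi} (\<lambda>u. (f' u)\<^sup>2 / ?v u) + integral {0..2 * pi} (\<lambda>u. (g' u)\<^sup>2 / ?v u)"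
    using wirtinger by simp
  also have "\<dots> = integral {0..2 * pi} (\<lambda>u. (f' u)\<^sup>2 / ?v u + (g' u)\<^sup>2 / ?v u)"
    by (rule Henstock_Kurzweil_Integration.integral_add[symmetric]; intro int c_f'2 c_g'2)
  also have "(\<lambda>u. (f' u)\<^sup>2 / ?v u + (g' u)\<^sup>2 / ?v u) = ?v"
    unfolding add_divide_distrib[symmetric] sq
    by (simp add: fun_eq_iff power2_eq_square speed_nonzero)
  also have "integral {0..2 * pi} ?v = L" by (simp add: L_def curve_length_def)
  finally show ?thesis using L by (simp add: L_def[symmetric] field_simps power2_eq_square)
qed

end

section \<open>Smooth families of curves\<close>

text \<open>
  The conclusion includes that \<open>g_t t\<close> is differentiable. Differentiating
  \<open>g s b - g s a = \<integral> g_u s\<close> in time under the integral sign expresses \<open>g_t t b - g_t t a\<close> as an integral of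
  \<open>g_ut t\<close>, which can then be differentiated in \<open>b\<close>. This also works at an endpoint of \<open>J\<close>, where time
  derivatives are one-sided.
\<close>
lemma partial_derivatives_commute:
  fixes g :: "real \<Rightarrow> real \<Rightarrow> 'a::euclidean_space"
  assumes J: "convex J" "at t within J \<noteq> bot" "t \<in> J"
    and g_t: "\<And>s u. s \<in> J \<Longrightarrow> ((\<lambda>s. g s u) has_vector_derivative g_t s u) (at s within J)"
    and g_u: "\<And>s u. s \<in> J \<Longrightarrow> (g s has_vector_derivative g_u s u) (at u)"
    and g_ut: "\<And>s u. s \<in> J \<Longrightarrow> ((\<lambda>s. g_u s u) has_vector_derivative g_ut s u) (at s within J)"
    and cont_u: "\<And>s. s \<in> J \<Longrightarrow> continuous_on UNIV (g_u s)"
    and cont_ut: "continuous_on (J \<times> UNIV) (\<lambda>(s, u). g_ut s u)"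
  shows "(g_t t has_vector_derivative g_ut t u) (at u)"
proof -
  have ftc: "integral {a..b} (g_u s) = g s b - g s a" if "a \<le> b" "s \<in> J" for a b s
    using that g_u by (intro integral_unique fundamental_theorem_of_calculus)
      (auto intro: has_vector_derivative_at_within)
  have g_t_diff: "integral {a..b} (g_ut t) = g_t t b - g_t t a" if ab: "a \<le> b" for a b
  proof (rule vector_derivative_unique_within[OF J(2)])
    have "((\<lambda>s. integral (cbox a b) (g_u s)) has_vector_derivative integral (cbox a b) (g_ut t)) (at t within J)"
      using J g_ut cont_u by (intro leibniz_rule_vector_derivative)
        (auto intro!: integrable_continuous_real intro: continuous_on_subset cont_ut[THEN continuous_on_subset])
    then show "((\<lambda>s. g s b - g s a) has_vector_derivative integral {a..b} (g_ut t)) (at t within J)"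
      unfolding cbox_interval by (rule has_vector_derivative_transform[OF J(3), rotated 1]) (simp add: ftc[OF ab])
    show "((\<lambda>s. g s b - g s a) has_vector_derivative g_t t b - g_t t a) (at t within J)"
      by (intro derivative_intros g_t J)
  qed
  have "continuous_on {u - 1..u + 1} (\<lambda>x. (\<lambda>(s, u). g_ut s u) (t, x))"
    by (rule continuous_on_compose2[OF cont_ut continuous_on_Pair[OF continuous_on_const continuous_on_id]])
      (use J(3) in auto)
  then have c: "continuous_on {u - 1..u + 1} (g_ut t)" by simp
  have "((\<lambda>x. g_t t (u - 1) + integral {u - 1..x} (g_ut t)) has_vector_derivative g_ut t u) (at u within {u - 1..u + 1})"
    by (auto intro!: derivative_eq_intros integral_has_vector_derivative[OF c])
  then have "(g_t t has_vector_derivative g_ut t u) (at u within {u - 1..u + 1})"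
    by (rule has_vector_derivative_transform[rotated 2]) (auto simp: g_t_diff)
  then show ?thesis by (simp add: at_within_Icc_at)
qed

lemma C_on_cong:
  assumes C: "C_on n J f" and eq: "\<And>t u. t \<in> J \<Longrightarrow> f t u = g t u"
  shows "C_on n J g"
proof (cases n)
  case 0
  have "continuous_on (J \<times> UNIV) (\<lambda>(t, u). g t u) = continuous_on (J \<times> UNIV) (\<lambda>(t, u). f t u)"
    by (rule continuous_on_cong) (auto simp: eq)
  then show ?thesis using C 0 by simp
next
  case (Suc m)
  have "g t = f t" if "t \<in> J" for t using eq that by auto
  moreover have "((\<lambda>s. g s u) has_vector_derivative D) (at t within J)"
    if "t \<in> J" "((\<lambda>s. f s u) has_vector_derivative D) (at t within J)" for t u D
    by (rule has_vector_derivative_transform[OF that(1) _ that(2)]) (simp add: eq)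
  moreover obtain f_t f_u where "\<forall>t\<in>J. \<forall>u. ((\<lambda>s. f s u) has_vector_derivative f_t t u) (at t within J)
      \<and> (f t has_vector_derivative f_u t u) (at u)" "C_on m J f_t" "C_on m J f_u"
    using C unfolding Suc by auto
  ultimately show ?thesis
    unfolding Suc C_on.simps by (intro exI[of _ f_t] exI[of _ f_u]) auto
qed

lemma smooth_family_cong:
  assumes "smooth_family J f" "\<And>t u. t \<in> J \<Longrightarrow> f t u = g t u"
  shows "smooth_family J g"
  unfolding smooth_family_def
  by (intro allI C_on_cong[OF assms(1)[unfolded smooth_family_def, rule_format] assms(2)])

lemma smooth_family_continuous:
  "smooth_family J g \<Longrightarrow> continuous_on (J \<times> UNIV) (\<lambda>(t, u). g t u)"
  using C_on.simps(1)[of J g] by (simp only: smooth_family_def)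

definition time_derivative :: "real set \<Rightarrow> (real \<Rightarrow> real \<Rightarrow> complex) \<Rightarrow> real \<Rightarrow> real \<Rightarrow> complex" where
  "time_derivative J g t u = vector_derivative (\<lambda>s. g s u) (at t within J)"

text \<open>
  Smoothness provides, for each order separately, some pair of partial derivatives. Since derivatives are
  unique, these pairs all agree on \<open>J\<close> with the canonical ones, which are therefore smooth families again.
\<close>
lemma smooth_family_partial_derivatives:
  assumes g: "smooth_family J g" and J: "\<And>t. t \<in> J \<Longrightarrow> at t within J \<noteq> bot"
  shows "smooth_family J (time_derivative J g)" (is ?st)
    and "smooth_family J (\<lambda>t u. vector_derivative (g t) (at u))" (is ?su)
    and "t \<in> J \<Longrightarrow> ((\<lambda>s. g s u) has_vector_derivative time_derivative J g t u) (at t within J)" (is "_ \<Longrightarrow> ?dt")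
    and "t \<in> J \<Longrightarrow> (g t has_vector_derivative vector_derivative (g t) (at u)) (at u)" (is "_ \<Longrightarrow> ?du")
proof -
  have *: "C_on n J (time_derivative J g) \<and> C_on n J (\<lambda>t u. vector_derivative (g t) (at u)) \<and>
      (\<forall>t\<in>J. \<forall>u. ((\<lambda>s. g s u) has_vector_derivative time_derivative J g t u) (at t within J)
         \<and> (g t has_vector_derivative vector_derivative (g t) (at u)) (at u))" for n
  proof -
    have "C_on (Suc n) J g" using g by (simp only: smooth_family_def)
    then obtain g_t g_u where d: "\<forall>t\<in>J. \<forall>u. ((\<lambda>s. g s u) has_vector_derivative g_t t u) (at t within J)
        \<and> (g t has_vector_derivative g_u t u) (at u)" and C: "C_on n J g_t" "C_on n J g_u"
      by auto
    have t: "g_t t u = time_derivative J g t u" if "t \<in> J" for t u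
      using vector_derivative_within[OF J[OF that]] d that unfolding time_derivative_def by metis
    have u: "g_u t u = vector_derivative (g t) (at u)" if "t \<in> J" for t u
      using vector_derivative_at d that by metis
    have "C_on n J (time_derivative J g)" by (rule C_on_cong[OF C(1) t])
    moreover have "C_on n J (\<lambda>t u. vector_derivative (g t) (at u))" by (rule C_on_cong[OF C(2) u])
    ultimately show ?thesis using d t u by auto
  qed
  show ?st ?su using * by (auto simp: smooth_family_def)
  show "t \<in> J \<Longrightarrow> ?dt" "t \<in> J \<Longrightarrow> ?du" using * by auto
qed

section \<open>The curve diffusion flow\<close>

locale curve_diffusion =
  fixes \<gamma>0 :: "real \<Rightarrow> complex" and T :: ereal and \<gamma> :: "real \<Rightarrow> real \<Rightarrow> complex"
  assumes solution: "curve_diffusion_solution \<gamma>0 T \<gamma>"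
begin

abbreviation J where "J \<equiv> time_interval T"

abbreviation \<gamma>\<^sub>u where "\<gamma>\<^sub>u t \<equiv> immersed_curve.c1 (\<gamma> t)"
abbreviation \<gamma>\<^sub>u\<^sub>u where "\<gamma>\<^sub>u\<^sub>u t \<equiv> immersed_curve.c2 (\<gamma> t)"

abbreviation velocity where "velocity \<equiv> time_derivative J \<gamma>"
abbreviation \<gamma>\<^sub>u\<^sub>t where "\<gamma>\<^sub>u\<^sub>t \<equiv> time_derivative J \<gamma>\<^sub>u"
abbreviation \<gamma>\<^sub>u\<^sub>u\<^sub>t where "\<gamma>\<^sub>u\<^sub>u\<^sub>t \<equiv> time_derivative J \<gamma>\<^sub>u\<^sub>u"

lemma immersed_slice: "t \<in> J \<Longrightarrow> immersed_curve (\<gamma> t)"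
  using solution by (simp add: curve_diffusion_solution_def immersed_curve_def)

lemma initial: "0 \<in> J" "\<gamma> 0 = \<gamma>0"
  using solution by (simp_all add: curve_diffusion_solution_def time_interval_def zero_ereal_def)

lemma initial_segment_subset: "b \<in> J \<Longrightarrow> {0..b} \<subseteq> J"
  unfolding time_interval_def by (auto intro: le_less_trans[of "ereal _" "ereal b"])

lemma convex_J: "convex J"
  unfolding is_interval_convex_1[symmetric] is_interval_1
  using initial_segment_subset by (fastforce simp: time_interval_def)

lemma at_within_J_not_bot:
  assumes "t \<in> J"
  shows "at t within J \<noteq> bot"
proof -
  obtain r where r: "0 < ereal r" "ereal r < T"
    using solution ereal_dense2[of 0 T] by (auto simp: curve_diffusion_solution_def)
  then have "r \<in> J" "r \<noteq> 0" by (simp_all add: time_interval_def)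
  then have "\<nexists>x. J = {x}" using initial(1) by auto
  then show ?thesis
    using connected_imp_perfect[OF convex_connected[OF convex_J] assms] by (simp add: trivial_limit_within)
qed

lemma smooth_families: "smooth_family J \<gamma>" "smooth_family J \<gamma>\<^sub>u" "smooth_family J \<gamma>\<^sub>u\<^sub>u"
proof -
  note partial = smooth_family_partial_derivatives(2)[OF _ at_within_J_not_bot]
  show 0: "smooth_family J \<gamma>"
    using solution by (simp add: curve_diffusion_solution_def)
  show 1: "smooth_family J \<gamma>\<^sub>u"
    using partial[OF 0] by (rule smooth_family_cong) (simp_all add: immersed_curve.c1_def[OF immersed_slice])
  show "smooth_family J \<gamma>\<^sub>u\<^sub>u"
    using partial[OF 1] by (rule smooth_family_cong) (simp_all add: immersed_curve.c2_def[OF immersed_slice])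
qed

lemma smooth_family_time_derivative:
  "smooth_family J f \<Longrightarrow> smooth_family J (time_derivative J f)"
  by (rule smooth_family_partial_derivatives(1)[OF _ at_within_J_not_bot])

lemma has_time_derivative:
  "smooth_family J f \<Longrightarrow> t \<in> J \<Longrightarrow> ((\<lambda>s. f s u) has_vector_derivative time_derivative J f t u) (at t within J)"
  by (rule smooth_family_partial_derivatives(3)[OF _ at_within_J_not_bot])

lemma time_derivative_has_derivative:
  assumes f: "smooth_family J f" "smooth_family J f_u" and t: "t \<in> J"
    and f_u: "\<And>t u. t \<in> J \<Longrightarrow> (f t has_vector_derivative f_u t u) (at u)"
  shows "(time_derivative J f t has_vector_derivative time_derivative J f_u t u) (at u)"
proof (rule partial_derivatives_commute[where g = f and g_u = f_u, OF convex_J at_within_J_not_bot[OF t] t])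
  show "continuous_on UNIV (f_u s)" if "s \<in> J" for s
  proof -
    have "continuous_on UNIV (\<lambda>x. (\<lambda>(s, u). f_u s u) (s, x))"
      by (rule continuous_on_compose2[OF smooth_family_continuous[OF f(2)]
            continuous_on_Pair[OF continuous_on_const continuous_on_id]]) (use that in auto)
    then show ?thesis by simp
  qed
qed (use f f_u has_time_derivative smooth_family_time_derivative smooth_family_continuous in blast)+

lemma slice_derivatives:
  assumes "t \<in> J"
  shows "(velocity t has_vector_derivative \<gamma>\<^sub>u\<^sub>t t u) (at u)"
    and "(\<gamma>\<^sub>u\<^sub>t t has_vector_derivative \<gamma>\<^sub>u\<^sub>u\<^sub>t t u) (at u)"
  using smooth_families assms immersed_curve.has_derivatives[OF immersed_slice]
  by (intro time_derivative_has_derivative; blast)+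

lemma velocity_periodic:
  assumes "t \<in> J"
  shows "velocity t (u + 2 * pi) = velocity t u"
proof -
  have "\<gamma> s (u + 2 * pi) = \<gamma> s u" if "s \<in> J" for s
    using immersed_curve.derivatives_periodic(1)[OF immersed_slice[OF that]] .
  moreover note d = has_time_derivative[OF smooth_families(1)]
  ultimately have "((\<lambda>s. \<gamma> s u) has_vector_derivative velocity t (u + 2 * pi)) (at t within J)"
    by (intro has_vector_derivative_transform[OF assms _ d[OF assms]]) simp
  then show ?thesis
    by (rule vector_derivative_unique_within[OF at_within_J_not_bot[OF assms] _ d[OF assms]])
qed

lemma normal_velocity:
  "t \<in> J \<Longrightarrow> velocity t u \<bullet> unit_normal (\<gamma> t) u = - arc_deriv (\<gamma> t) (arc_deriv (\<gamma> t) (curvature (\<gamma> t))) u"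
  using solution by (simp add: curve_diffusion_solution_def time_derivative_def)

text \<open>
  Differentiation under the integral sign yields the first variation in the direction of the velocity, whose
  normal component is minus the second arc-length derivative of the curvature.
\<close>
lemma curve_length_has_derivative:
  assumes t: "t \<in> J"
  shows "((\<lambda>s. curve_length (\<gamma> s)) has_real_derivative
           - arc_integral (\<gamma> t) (\<lambda>u. (arc_deriv (\<gamma> t) (curvature (\<gamma> t)) u)\<^sup>2)) (at t within J)"
proof -
  note d = has_time_derivative[OF smooth_families(2)] slice_derivatives(1)
  note c = smooth_families(2)[THEN smooth_family_continuous]
    smooth_families(2)[THEN smooth_family_time_derivative, THEN smooth_family_continuous]
  interpret immersed_curve "\<gamma> t" by (rule immersed_slice[OF t])
  let ?f = "\<lambda>s u. (\<gamma>\<^sub>u s u \<bullet> \<gamma>\<^sub>u\<^sub>t s u) / norm (\<gamma>\<^sub>u s u)"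
  have nz: "\<gamma>\<^sub>u s u \<noteq> 0" if "s \<in> J" for s u
    using immersed_curve.c1_nonzero[OF immersed_slice[OF that]] .
  have "((\<lambda>s. integral (cbox 0 (2 * pi)) (\<lambda>u. norm (\<gamma>\<^sub>u s u))) has_vector_derivative
      integral (cbox 0 (2 * pi)) (?f t)) (at t within J)"
  proof (rule leibniz_rule_vector_derivative[OF _ _ _ t convex_J])
    fix s u assume s: "s \<in> J"
    show "((\<lambda>s. norm (\<gamma>\<^sub>u s u)) has_vector_derivative ?f s u) (at s within J)"
      by (rule has_vector_derivative_norm[OF d(1)[OF s] nz[OF s]])
  next
    fix s assume s: "s \<in> J"
    show "(\<lambda>u. norm (\<gamma>\<^sub>u s u)) integrable_on cbox 0 (2 * pi)"
      unfolding cbox_interval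
      by (intro integrable_continuous_real continuous_intros
          immersed_curve.continuous_derivatives[OF immersed_slice[OF s]])
  next
    have "continuous_on (J \<times> cbox 0 (2 * pi)) (\<lambda>(t, u). \<gamma>\<^sub>u t u)"
      "continuous_on (J \<times> cbox 0 (2 * pi)) (\<lambda>(t, u). \<gamma>\<^sub>u\<^sub>t t u)"
      by (auto intro: continuous_on_subset[OF c(1)] continuous_on_subset[OF c(2)])
    then show "continuous_on (J \<times> cbox 0 (2 * pi)) (\<lambda>(s, u). ?f s u)"
      using nz unfolding split_beta by (intro continuous_intros) auto
  qed
  also have "integral (cbox 0 (2 * pi)) (?f t) =
      - arc_integral (\<gamma> t) (\<lambda>u. (arc_deriv (\<gamma> t) (curvature (\<gamma> t)) u)\<^sup>2)"
    using first_variation_of_length[OF d(2)[OF t] velocity_periodic[OF t]] curvature_dissipation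
    by (simp add: normal_velocity[OF t] arc_integral_def)
  finally have D: "((\<lambda>s. integral (cbox 0 (2 * pi)) (\<lambda>u. norm (\<gamma>\<^sub>u s u))) has_vector_derivative
      - arc_integral (\<gamma> t) (\<lambda>u. (arc_deriv (\<gamma> t) (curvature (\<gamma> t)) u)\<^sup>2)) (at t within J)" .
  have eq: "curve_length (\<gamma> s) = integral (cbox 0 (2 * pi)) (\<lambda>u. norm (\<gamma>\<^sub>u s u))" if "s \<in> J" for s
    by (simp add: curve_length_def immersed_curve.speed_eq[OF immersed_slice[OF that], abs_def])
  show ?thesis
    unfolding has_real_derivative_iff_has_vector_derivative
    by (rule has_vector_derivative_transform[OF t eq D])
qed

lemma constant_in_time:
  fixes F :: "real \<Rightarrow> 'a::real_normed_vector"
  assumes "\<And>t. t \<in> J \<Longrightarrow> (F has_vector_derivative 0) (at t within J)" "t \<in> J"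
  shows "F t = F 0"
  using has_derivative_zero_constant[OF convex_J, of F] assms initial(1)
  by (auto simp: has_vector_derivative_def)

lemma enclosed_area_constant:
  assumes "t \<in> J"
  shows "enclosed_area (\<gamma> t) = enclosed_area \<gamma>0"
proof -
  note d = smooth_families(1,2)[THEN has_time_derivative] slice_derivatives(1)
  note c = smooth_families(1,2)[THEN smooth_family_continuous]
    smooth_families(1,2)[THEN smooth_family_time_derivative, THEN smooth_family_continuous]
  let ?f = "\<lambda>s u. \<gamma> s u \<bullet> (\<i> * \<gamma>\<^sub>u\<^sub>t s u) + velocity s u \<bullet> (\<i> * \<gamma>\<^sub>u s u)"
  have "((\<lambda>s. integral (cbox 0 (2 * pi)) (\<lambda>u. \<gamma> s u \<bullet> (\<i> * \<gamma>\<^sub>u s u))) has_vector_derivative 0) (at t within J)"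
    if t: "t \<in> J" for t
  proof -
    interpret immersed_curve "\<gamma> t" by (rule immersed_slice[OF t])
    have "((\<lambda>s. integral (cbox 0 (2 * pi)) (\<lambda>u. \<gamma> s u \<bullet> (\<i> * \<gamma>\<^sub>u s u))) has_vector_derivative
        integral (cbox 0 (2 * pi)) (?f t)) (at t within J)"
    proof (rule leibniz_rule_vector_derivative[OF _ _ _ t convex_J])
      fix s u assume s: "s \<in> J"
      show "((\<lambda>s. \<gamma> s u \<bullet> (\<i> * \<gamma>\<^sub>u s u)) has_vector_derivative ?f s u) (at s within J)"
        by (intro bounded_bilinear.has_vector_derivative[OF bounded_bilinear_inner]
            has_vector_derivative_mult_right d s)
    next
      fix s assume s: "s \<in> J"
      show "(\<lambda>u. \<gamma> s u \<bullet> (\<i> * \<gamma>\<^sub>u s u)) integrable_on cbox 0 (2 * pi)"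
        unfolding cbox_interval
        by (intro integrable_continuous_real continuous_intros
          immersed_curve.continuous_derivatives[OF immersed_slice[OF s]])
    next
      have "continuous_on (J \<times> cbox 0 (2 * pi)) (\<lambda>(t, u). \<gamma> t u)"
        "continuous_on (J \<times> cbox 0 (2 * pi)) (\<lambda>(t, u). velocity t u)"
        "continuous_on (J \<times> cbox 0 (2 * pi)) (\<lambda>(t, u). \<gamma>\<^sub>u t u)"
        "continuous_on (J \<times> cbox 0 (2 * pi)) (\<lambda>(t, u). \<gamma>\<^sub>u\<^sub>t t u)"
        by (auto intro: c[THEN continuous_on_subset])
      then show "continuous_on (J \<times> cbox 0 (2 * pi)) (\<lambda>(s, u). ?f s u)"
        unfolding split_beta by (intro continuous_intros)
    qed
    also have "integral (cbox 0 (2 * pi)) (?f t) = 2 * arc_integral (\<gamma> t) (\<lambda>u. velocity t u \<bullet> unit_normal (\<gamma> t) u)"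
      using first_variation_of_area[OF d(3)[OF t] velocity_periodic[OF t]] by simp
    also have "\<dots> = 0"
      using second_curvature_derivative_integral by (simp add: normal_velocity[OF t] arc_integral_def)
    finally show ?thesis .
  qed
  from constant_in_time[OF this assms] show ?thesis
    using immersed_curve.enclosed_area_eq[OF immersed_slice] initial assms by auto
qed

text \<open>
  The total curvature is the integral of the imaginary part of the logarithmic derivative of \<open>\<gamma>\<^sub>u\<close>. Its time
  derivative is the integral of the parameter derivative of \<open>Im (\<gamma>\<^sub>u\<^sub>t / \<gamma>\<^sub>u)\<close>, which is periodic.
\<close>
lemma total_curvature_constant:
  assumes "t \<in> J"
  shows "arc_integral (\<gamma> t) (curvature (\<gamma> t)) = arc_integral \<gamma>0 (curvature \<gamma>0)"
proof -
  note d = smooth_families(2,3)[THEN has_time_derivative] slice_derivatives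
  note c = smooth_families(2,3)[THEN smooth_family_continuous]
    smooth_families(2,3)[THEN smooth_family_time_derivative, THEN smooth_family_continuous]
  have nz: "\<gamma>\<^sub>u s u \<noteq> 0" if "s \<in> J" for s u
    using immersed_curve.c1_nonzero[OF immersed_slice[OF that]] .
  let ?f = "\<lambda>s u. (\<gamma>\<^sub>u\<^sub>u\<^sub>t s u * \<gamma>\<^sub>u s u - \<gamma>\<^sub>u\<^sub>u s u * \<gamma>\<^sub>u\<^sub>t s u) / (\<gamma>\<^sub>u s u * \<gamma>\<^sub>u s u)"
  have "((\<lambda>s. integral (cbox 0 (2 * pi)) (\<lambda>u. Im (\<gamma>\<^sub>u\<^sub>u s u / \<gamma>\<^sub>u s u))) has_vector_derivative 0) (at t within J)"
    if t: "t \<in> J" for t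
  proof -
    interpret immersed_curve "\<gamma> t" by (rule immersed_slice[OF t])
    have "((\<lambda>s. integral (cbox 0 (2 * pi)) (\<lambda>u. Im (\<gamma>\<^sub>u\<^sub>u s u / \<gamma>\<^sub>u s u))) has_vector_derivative
        integral (cbox 0 (2 * pi)) (\<lambda>u. Im (?f t u))) (at t within J)"
    proof (rule leibniz_rule_vector_derivative[OF _ _ _ t convex_J])
      fix s u assume s: "s \<in> J"
      show "((\<lambda>s. Im (\<gamma>\<^sub>u\<^sub>u s u / \<gamma>\<^sub>u s u)) has_vector_derivative Im (?f s u)) (at s within J)"
        by (intro bounded_linear.has_vector_derivative[OF bounded_linear_Im]
            has_vector_derivative_quotient d s nz)
    next
      fix s assume s: "s \<in> J"
      show "(\<lambda>u. Im (\<gamma>\<^sub>u\<^sub>u s u / \<gamma>\<^sub>u s u)) integrable_on cbox 0 (2 * pi)"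
        unfolding cbox_interval using nz[OF s]
        by (intro integrable_continuous_real continuous_intros
          immersed_curve.continuous_derivatives[OF immersed_slice[OF s]]) auto
    next
      have "continuous_on (J \<times> cbox 0 (2 * pi)) (\<lambda>(t, u). \<gamma>\<^sub>u t u)"
        "continuous_on (J \<times> cbox 0 (2 * pi)) (\<lambda>(t, u). \<gamma>\<^sub>u\<^sub>u t u)"
        "continuous_on (J \<times> cbox 0 (2 * pi)) (\<lambda>(t, u). \<gamma>\<^sub>u\<^sub>t t u)"
        "continuous_on (J \<times> cbox 0 (2 * pi)) (\<lambda>(t, u). \<gamma>\<^sub>u\<^sub>u\<^sub>t t u)"
        by (auto intro: c[THEN continuous_on_subset])
      then show "continuous_on (J \<times> cbox 0 (2 * pi)) (\<lambda>(s, u). Im (?f s u))"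
        using nz unfolding split_beta by (intro continuous_intros) auto
    qed
    also have "integral (cbox 0 (2 * pi)) (\<lambda>u. Im (?f t u)) = 0"
    proof -
      have "((\<lambda>u. Im (\<gamma>\<^sub>u\<^sub>t t u / \<gamma>\<^sub>u t u)) has_vector_derivative
          Im ((\<gamma>\<^sub>u\<^sub>u\<^sub>t t u * \<gamma>\<^sub>u t u - \<gamma>\<^sub>u\<^sub>t t u * \<gamma>\<^sub>u\<^sub>u t u) / (\<gamma>\<^sub>u t u * \<gamma>\<^sub>u t u))) (at u)" for u
        by (intro bounded_linear.has_vector_derivative[OF bounded_linear_Im]
            has_vector_derivative_quotient d has_derivatives t nz)
      moreover have "\<gamma>\<^sub>u\<^sub>t t (u + 2 * pi) = \<gamma>\<^sub>u\<^sub>t t u" for u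
        using d(3)[OF t] velocity_periodic[OF t] by (rule periodic_derivative)
      ultimately have "((\<lambda>u. Im ((\<gamma>\<^sub>u\<^sub>u\<^sub>t t u * \<gamma>\<^sub>u t u - \<gamma>\<^sub>u\<^sub>t t u * \<gamma>\<^sub>u\<^sub>u t u) / (\<gamma>\<^sub>u t u * \<gamma>\<^sub>u t u)))
          has_integral 0) {0..2 * pi}"
        by (intro has_integral_periodic_derivative[of "\<lambda>u. Im (\<gamma>\<^sub>u\<^sub>t t u / \<gamma>\<^sub>u t u)"])
          (simp_all only: derivatives_periodic)
      then show ?thesis by (simp add: integral_unique mult.commute)
    qed
    finally show ?thesis .
  qed
  from constant_in_time[OF this assms] show ?thesis
    using immersed_curve.arc_integral_curvature_eq[OF immersed_slice]
      immersed_curve.log_deriv_def[OF immersed_slice] initial assms by auto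
qed

definition nonconvex_times :: "real set" where
  "nonconvex_times = {t \<in> J. \<exists>p. curvature (\<gamma> t) p \<le> 0}"

text \<open>
  The set is the projection of a closed subset of a compact rectangle, because the curvature is jointly
  continuous and periodic in the parameter. This gives measurability.
\<close>
lemma compact_nonconvex_times:
  assumes b: "b \<in> J"
  shows "compact (nonconvex_times \<inter> {0..b})"
proof -
  note c = smooth_families(2,3)[THEN smooth_family_continuous]
  note sub = initial_segment_subset[OF b]
  let ?R = "{0..b} \<times> {0..2 * pi}"
  have "continuous_on ?R (\<lambda>(t, u). \<gamma>\<^sub>u t u)" "continuous_on ?R (\<lambda>(t, u). \<gamma>\<^sub>u\<^sub>u t u)"
    using sub by (auto intro!: c[THEN continuous_on_subset])
  moreover have "\<gamma>\<^sub>u s u \<noteq> 0" if "s \<in> {0..b}" for s u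
    using immersed_curve.c1_nonzero[OF immersed_slice] sub that by blast
  ultimately have "continuous_on ?R (\<lambda>(t, u). Im (\<gamma>\<^sub>u\<^sub>u t u / \<gamma>\<^sub>u t u) / norm (\<gamma>\<^sub>u t u))"
    unfolding split_beta by (intro continuous_intros) auto
  moreover have "curvature (\<gamma> t) u = Im (\<gamma>\<^sub>u\<^sub>u t u / \<gamma>\<^sub>u t u) / norm (\<gamma>\<^sub>u t u)" if "t \<in> {0..b}" for t u
    using immersed_slice that sub
    by (simp add: immersed_curve.curvature_eq immersed_curve.log_deriv_def immersed_curve.speed_eq subset_iff)
  ultimately have "continuous_on ?R (\<lambda>(t, u). curvature (\<gamma> t) u)"
    by (subst continuous_on_cong[OF refl]) auto
  then have "closed (?R \<inter> (\<lambda>(t, u). curvature (\<gamma> t) u) -` {..0})"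
    by (intro continuous_closed_preimage closed_Times) auto
  moreover have "compact ?R" by (intro compact_Times) auto
  ultimately have "compact (?R \<inter> (\<lambda>(t, u). curvature (\<gamma> t) u) -` {..0})"
    using compact_Int_closed[of ?R "?R \<inter> (\<lambda>(t, u). curvature (\<gamma> t) u) -` {..0}"] by (simp add: Int_assoc[symmetric])
  then have "compact (fst ` (?R \<inter> (\<lambda>(t, u). curvature (\<gamma> t) u) -` {..0}))"
    by (intro compact_continuous_image continuous_intros)
  also have "fst ` (?R \<inter> (\<lambda>(t, u). curvature (\<gamma> t) u) -` {..0}) = nonconvex_times \<inter> {0..b}"
  proof (intro equalityI subsetI)
    fix t assume t: "t \<in> nonconvex_times \<inter> {0..b}"
    then obtain p where "curvature (\<gamma> t) p \<le> 0" by (auto simp: nonconvex_times_def)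
    moreover obtain r where "r \<in> {0..2 * pi}" "curvature (\<gamma> t) r = curvature (\<gamma> t) p"
      using periodic_value_in_period[of "curvature (\<gamma> t)" "2 * pi" p] t
        immersed_curve.curvature_periodic[OF immersed_slice] by (auto simp: nonconvex_times_def)
    ultimately have "(t, r) \<in> ?R \<inter> (\<lambda>(t, u). curvature (\<gamma> t) u) -` {..0}" using t by auto
    then show "t \<in> fst ` (?R \<inter> (\<lambda>(t, u). curvature (\<gamma> t) u) -` {..0})" by force
  qed (use sub in \<open>auto simp: nonconvex_times_def\<close>)
  finally show ?thesis .
qed

text \<open>
  The function \<open>g\<close> below is the rate of decrease of \<open>(L / (2 * pi))\<^sup>4\<close>. It dominates the indicator function
  of the bad times, and as a derivative it is gauge integrable with the length drop as its integral.
\<close>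
lemma measure_nonconvex_times_le_length_drop:
  assumes turn: "arc_integral \<gamma>0 (curvature \<gamma>0) = 2 * pi" and b: "b \<in> J"
  shows "measure lebesgue (nonconvex_times \<inter> {0..b})
     \<le> (curve_length \<gamma>0 / (2 * pi)) ^ 4 - (curve_length (\<gamma> b) / (2 * pi)) ^ 4"
proof -
  define E where "E t = arc_integral (\<gamma> t) (\<lambda>u. (arc_deriv (\<gamma> t) (curvature (\<gamma> t)) u)\<^sup>2)" for t
  define g where "g t = curve_length (\<gamma> t) ^ 3 * E t / (4 * pi ^ 4)" for t
  note sub = initial_segment_subset[OF b]
  have "((\<lambda>t. - ((curve_length (\<gamma> t) / (2 * pi)) ^ 4)) has_real_derivative g t) (at t within {0..b})"
    if "t \<in> {0..b}" for t
  proof -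
    have "((\<lambda>s. curve_length (\<gamma> s)) has_real_derivative - E t) (at t within {0..b})"
      unfolding E_def
      by (rule has_field_derivative_subset[OF curve_length_has_derivative sub]) (use sub that in blast)
    then have "((\<lambda>s. - ((curve_length (\<gamma> s) / (2 * pi)) ^ 4)) has_real_derivative
        - (4 * (curve_length (\<gamma> t) / (2 * pi)) ^ 3 * (- E t / (2 * pi)))) (at t within {0..b})"
      by (auto intro!: derivative_eq_intros)
    also have "- (4 * (curve_length (\<gamma> t) / (2 * pi)) ^ 3 * (- E t / (2 * pi))) = g t"
      by (simp add: g_def power_divide power_mult_distrib power4_eq_xxxx power3_eq_cube)
    finally show ?thesis .
  qed
  then have "(g has_integral - ((curve_length (\<gamma> b) / (2 * pi)) ^ 4) - - ((curve_length (\<gamma> 0) / (2 * pi)) ^ 4)) {0..b}"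
    using b by (intro fundamental_theorem_of_calculus)
      (auto simp: has_real_derivative_iff_has_vector_derivative time_interval_def)
  then have "(g has_integral (curve_length \<gamma>0 / (2 * pi)) ^ 4 - (curve_length (\<gamma> b) / (2 * pi)) ^ 4) {0..b}"
    by (simp add: initial(2))
  then have drop: "((\<lambda>t. if t \<in> {0..b} then g t else 0) has_integral
      (curve_length \<gamma>0 / (2 * pi)) ^ 4 - (curve_length (\<gamma> b) / (2 * pi)) ^ 4) UNIV"
    by (simp only: has_integral_restrict_UNIV)
  have ind: "(indicat_real (nonconvex_times \<inter> {0..b}) has_integral
      measure lebesgue (nonconvex_times \<inter> {0..b})) UNIV"
    using lmeasurable_compact[OF compact_nonconvex_times[OF b]] lmeasurable_iff_has_integral by blast
  have le: "indicat_real (nonconvex_times \<inter> {0..b}) t \<le> (if t \<in> {0..b} then g t else 0)" for t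
  proof (cases "t \<in> {0..b}")
    case True
    then interpret immersed_curve "\<gamma> t" using immersed_slice sub by blast
    have "0 \<le> E t" unfolding E_def arc_integral_def
      by (intro integral_nonneg integrable_continuous_real continuous_intros) (simp add: less_imp_le speed_pos)
    then have "0 \<le> g t" using curve_length_pos by (simp add: g_def)
    moreover have "1 \<le> g t" if "t \<in> nonconvex_times"
    proof -
      have tJ: "t \<in> J" using that by (simp add: nonconvex_times_def)
      have "4 * pi ^ 4 \<le> curve_length (\<gamma> t) ^ 3 * E t"
        using that dissipation_lower_bound total_curvature_constant[OF tJ] turn
        by (auto simp: E_def nonconvex_times_def)
      then show ?thesis by (simp add: g_def)
    qed
    ultimately show ?thesis using True by (simp add: indicator_def)
  qed (auto simp: indicator_def)
  show ?thesis by (rule has_integral_le[OF ind drop le])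
qed

text \<open>
  The time interval is exhausted by compact intervals, on each of which the length drop is limited by the
  isoperimetric inequality at the final time.
\<close>
lemma nonconvex_times_measure_bound:
  assumes turn: "arc_integral \<gamma>0 (curvature \<gamma>0) = 2 * pi" and area: "0 \<le> enclosed_area \<gamma>0"
  shows "nonconvex_times \<in> lmeasurable"
    and "measure lebesgue nonconvex_times \<le> (curve_length \<gamma>0 / (2 * pi)) ^ 4 - (enclosed_area \<gamma>0 / pi)\<^sup>2"
proof -
  let ?M = "(curve_length \<gamma>0 / (2 * pi)) ^ 4 - (enclosed_area \<gamma>0 / pi)\<^sup>2"
  obtain X :: "nat \<Rightarrow> real" where X: "incseq X" "\<And>i. 0 < ereal (X i)" "\<And>i. ereal (X i) < T" "(\<lambda>i. ereal (X i)) \<longlonglongrightarrow> T"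
    using ereal_incseq_approx[of 0 T] solution unfolding curve_diffusion_solution_def by metis
  have XJ: "X i \<in> J" for i using X(2,3)[of i] by (simp add: time_interval_def)
  have bound: "measure lebesgue (nonconvex_times \<inter> {0..X i}) \<le> ?M" for i
  proof -
    let ?L = "curve_length (\<gamma> (X i))"
    have "4 * pi * enclosed_area \<gamma>0 \<le> ?L\<^sup>2"
      using immersed_curve.isoperimetric_inequality[OF immersed_slice[OF XJ]] enclosed_area_constant[OF XJ] by simp
    then have "(4 * pi * enclosed_area \<gamma>0)\<^sup>2 \<le> (?L\<^sup>2)\<^sup>2"
      using area by (intro power_mono) auto
    then have "(enclosed_area \<gamma>0 / pi)\<^sup>2 \<le> (?L / (2 * pi)) ^ 4"
      by (simp add: power_divide power2_eq_square power4_eq_xxxx field_simps)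
    then show ?thesis using measure_nonconvex_times_le_length_drop[OF turn XJ, of i] by linarith
  qed
  have nested: "nonconvex_times \<inter> {0..X i} \<subseteq> nonconvex_times \<inter> {0..X (Suc i)}" for i
    using incseq_SucD[OF X(1), of i] by auto
  have meas: "nonconvex_times \<inter> {0..X i} \<in> lmeasurable" for i
    by (rule lmeasurable_compact[OF compact_nonconvex_times[OF XJ]])
  have union: "(\<Union>i. nonconvex_times \<inter> {0..X i}) = nonconvex_times"
  proof (intro equalityI subsetI)
    fix t assume t: "t \<in> nonconvex_times"
    then have "ereal t < T" "0 \<le> t" by (auto simp: nonconvex_times_def time_interval_def)
    then have "\<exists>i. ereal t < ereal (X i)"
      using order_tendstoD(1)[OF X(4)] eventually_sequentially by (metis order_refl)
    then obtain i where "t < X i" by auto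
    then show "t \<in> (\<Union>i. nonconvex_times \<inter> {0..X i})" using t \<open>0 \<le> t\<close> by (auto intro: less_imp_le)
  qed auto
  show "nonconvex_times \<in> lmeasurable"
    using measurable_nested_Union[where S = "\<lambda>i. nonconvex_times \<inter> {0..X i}", OF meas bound nested] by (simp only: union)
  show "measure lebesgue nonconvex_times \<le> ?M"
  proof (rule LIMSEQ_le_const2)
    show "(\<lambda>i. measure lebesgue (nonconvex_times \<inter> {0..X i})) \<longlonglongrightarrow> measure lebesgue nonconvex_times"
      using measure_nested_Union[where S = "\<lambda>i. nonconvex_times \<inter> {0..X i}", OF meas bound nested]
      by (simp only: union)
  qed (use bound in blast)
qed

end

theorem proposition1p5:
  fixes \<gamma>0 :: "real \<Rightarrow> complex" and \<gamma> :: "real \<Rightarrow> real \<Rightarrow> complex" and T :: ereal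
  assumes "immersed_closed_curve \<gamma>0"
    and "enclosed_area \<gamma>0 > 0"
    and "arc_integral \<gamma>0 (curvature \<gamma>0) = 2 * pi"
    and "K_osc \<gamma>0 < K_star"
    and "isoperimetric_ratio \<gamma>0 < exp (K_star / (8 * pi\<^sup>2))"
    and "curve_diffusion_flow \<gamma>0 T \<gamma>"
  shows "{t \<in> time_interval T. \<exists>p. curvature (\<gamma> t) p \<le> 0} \<in> lmeasurable \<and>
    measure lebesgue {t \<in> time_interval T. \<exists>p. curvature (\<gamma> t) p \<le> 0}
      \<le> (curve_length \<gamma>0 / (2 * pi)) ^ 4 - (enclosed_area \<gamma>0 / pi)\<^sup>2"
proof -
  interpret curve_diffusion \<gamma>0 T \<gamma>
    using assms(6) by unfold_locales (simp add: curve_diffusion_flow_def)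
  show ?thesis
    using nonconvex_times_measure_bound assms(2,3) by (simp add: nonconvex_times_def)
qed

end
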